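(* Let $n\in\{1,2\}$ and let $k\geq 1$ be any integer. Then every $n$-qubit gate $U\in\mathcal{C}_k$ is a semi-Clifford operation.
   Context: An $n$-qubit gate is a unitary operator on $(\mathbb{C}^2)^{\otimes n}$. The $n$-qubit Pauli group $\mathcal{P}_n$ is the group of order $4^{n+1}$ of all operators $c\,\sigma_1\otimes\cdots\otimes\sigma_n$ with $c\in\{\pm1,\pm i\}$ and $\sigma_j\in\{I,X,Y,Z\}$ (the identity and the Pauli matrices). The sets $\mathcal{C}_k$ (for fixed $n$) are defined recursively as sets of $n$-qubit unitaries: $\mathcal{C}_1=\mathcal{P}_n$ and $\mathcal{C}_{k+1}=\{U : U\mathcal{C}_1U^{\dagger}\subseteq\mathcal{C}_k\}$ for $k\ge 1$. An $n$-qubit unitary $U$ is called semi-Clifford if there is at least one maximal abelian subgroup $G$ of $\mathcal{P}_n$ such that $UGU^{\dagger}$ is a maximal abelian subgroup of $\mathcal{P}_n$ (possibly equal to $G$). *)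

theory Defs
  imports "Jordan_Normal_Form.Schur_Decomposition" "HOL-Algebra.Coset"
begin

text \<open>Operators on the \<open>n\<close>-fold tensor power of \<open>\<complex>\<^sup>2\<close> are represented by their
  matrices in the computational basis, i.e. by elements of \<^term>\<open>carrier_mat (2 ^ n) (2 ^ n)\<close>.
  The first tensor factor corresponds to the most significant bit of an index.\<close>

definition kronecker :: "complex mat \<Rightarrow> complex mat \<Rightarrow> complex mat" where
  "kronecker A B =
     mat (dim_row A * dim_row B) (dim_col A * dim_col B)
       (\<lambda>(i, j). A $$ (i div dim_row B, j div dim_col B) * B $$ (i mod dim_row B, j mod dim_col B))"

definition tensor_list :: "complex mat list \<Rightarrow> complex mat" where
  "tensor_list As = foldr kronecker As (1\<^sub>m 1)"

definition unitary_gate :: "nat \<Rightarrow> complex mat \<Rightarrow> bool" where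
  "unitary_gate n U \<longleftrightarrow>
     U \<in> carrier_mat (2 ^ n) (2 ^ n) \<and>
     U * mat_adjoint U = 1\<^sub>m (2 ^ n) \<and> mat_adjoint U * U = 1\<^sub>m (2 ^ n)"

definition pauli_I :: "complex mat" where
  "pauli_I = 1\<^sub>m 2"

definition pauli_X :: "complex mat" where
  "pauli_X = mat_of_rows_list 2 [[0, 1], [1, 0]]"

definition pauli_Y :: "complex mat" where
  "pauli_Y = mat_of_rows_list 2 [[0, - \<i>], [\<i>, 0]]"

definition pauli_Z :: "complex mat" where
  "pauli_Z = mat_of_rows_list 2 [[1, 0], [0, - 1]]"

definition pauli_set :: "nat \<Rightarrow> complex mat set" where
  "pauli_set n =
     {c \<cdot>\<^sub>m tensor_list ps | c ps.
        c \<in> {1, - 1, \<i>, - \<i>} \<and> length ps = n \<and> set ps \<subseteq> {pauli_I, pauli_X, pauli_Y, pauli_Z}}"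

definition pauli_group :: "nat \<Rightarrow> complex mat monoid" where
  "pauli_group n = \<lparr>carrier = pauli_set n, monoid.mult = (*), one = 1\<^sub>m (2 ^ n)\<rparr>"

definition conj_by :: "complex mat \<Rightarrow> complex mat \<Rightarrow> complex mat" where
  "conj_by U A = U * A * mat_adjoint U"

text \<open>The levels are numbered from \<open>1\<close>; the value at level \<open>0\<close> is a dummy.\<close>

fun clifford_hierarchy :: "nat \<Rightarrow> nat \<Rightarrow> complex mat set" where
  "clifford_hierarchy n 0 = {}"
| "clifford_hierarchy n (Suc 0) = pauli_set n"
| "clifford_hierarchy n (Suc (Suc k)) =
     {U. unitary_gate n U \<and>
         conj_by U ` clifford_hierarchy n (Suc 0) \<subseteq> clifford_hierarchy n (Suc k)}"

text \<open>Maximality is with respect to inclusion among the abelian subgroups of \<open>P\<close>.\<close>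

definition abelian_subgroup :: "'a set \<Rightarrow> ('a, 'b) monoid_scheme \<Rightarrow> bool" where
  "abelian_subgroup G P \<longleftrightarrow> subgroup G P \<and> comm_group (P\<lparr>carrier := G\<rparr>)"

definition maximal_abelian_subgroup :: "'a set \<Rightarrow> ('a, 'b) monoid_scheme \<Rightarrow> bool" where
  "maximal_abelian_subgroup G P \<longleftrightarrow>
     abelian_subgroup G P \<and> (\<forall>H. abelian_subgroup H P \<and> G \<subseteq> H \<longrightarrow> H = G)"

definition semi_clifford :: "nat \<Rightarrow> complex mat \<Rightarrow> bool" where
  "semi_clifford n U \<longleftrightarrow>
     unitary_gate n U \<and>
     (\<exists>G. maximal_abelian_subgroup G (pauli_group n) \<and>
          maximal_abelian_subgroup (conj_by U ` G) (pauli_group n))"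

end

theory Submission
  imports Defs
begin

text \<open>
  For two qubits, a gate \<open>U\<close> acts on the six-dimensional space of antisymmetric \<open>4 \<times> 4\<close> matrices by
  \<open>A \<mapsto> U A U\<^sup>T\<close>; this is the isogeny \<open>SU(4) \<rightarrow> SO(6)\<close>. In the basis of the six antisymmetric Pauli
  operators, every Pauli operator acts by a diagonal sign matrix whose eigenvalue \<open>1\<close> has
  multiplicity two, every pair of basis vectors arises in this way, and commuting independent Pauli
  operators correspond to disjoint pairs. So \<open>U\<close> is semi-Clifford if its \<open>6 \<times> 6\<close> unitary matrix \<open>Q\<close>
  maps two disjoint coordinate planes to coordinate planes.

  Now let \<open>U P U\<^sup>\<dagger>\<close> be semi-Clifford for all Pauli operators \<open>P\<close>. Up to sign these act as the reflections
  \<open>1 - 2 \<Pi>\<close>, where \<open>\<Pi>\<close> projects onto the span of two columns of \<open>Q\<close>. A Hermitian unitary matrix of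
  trace \<open>2\<close> that is block monomial with blocks of size at most two has exactly two more diagonal entries
  \<open>1\<close> than diagonal entries \<open>-1\<close>, because its remaining nonzero diagonal entries cancel in pairs.
  Hence any two columns of \<open>Q\<close> have at least two common zeros, which forces every column of \<open>Q\<close> to have
  at most two nonzero entries; orthogonality then makes \<open>Q\<close> block monomial, and \<open>U\<close> is
  semi-Clifford. The theorem follows by induction on the level, and one qubit reduces to two by
  tensoring with the identity.
\<close>

subsection \<open>Adjoints and Kronecker products\<close>

lemma mat_adjoint_dim [simp]:
  "dim_row (mat_adjoint A) = dim_col A" "dim_col (mat_adjoint A) = dim_row A"
  by (simp_all add: mat_adjoint_def)

lemma mat_adjoint_carrier [simp, intro]:
  "A \<in> carrier_mat m n \<Longrightarrow> mat_adjoint A \<in> carrier_mat n m"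
  by (intro carrier_matI) (simp_all only: mat_adjoint_dim carrier_matD)

lemma mat_adjoint_index [simp]:
  fixes A :: "complex mat"
  assumes "i < dim_col A" "j < dim_row A"
  shows "mat_adjoint A $$ (i, j) = cnj (A $$ (j, i))"
  using assms by (simp add: mat_adjoint_def mat_of_rows_index)

lemma mat_adjoint_mult:
  fixes A B :: "complex mat"
  assumes "A \<in> carrier_mat m n" "B \<in> carrier_mat n p"
  shows "mat_adjoint (A * B) = mat_adjoint B * mat_adjoint A"
  using assms by (intro eq_matI) (auto simp: scalar_prod_def mult.commute intro!: sum.cong)

lemma mat_adjoint_smult: "mat_adjoint (c \<cdot>\<^sub>m A) = cnj c \<cdot>\<^sub>m mat_adjoint A" for A :: "complex mat"
  by (intro eq_matI) auto

lemma mat_adjoint_adjoint [simp]: "mat_adjoint (mat_adjoint A) = A" for A :: "complex mat"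
  by (intro eq_matI) auto

lemma mat_adjoint_one [simp]: "mat_adjoint (1\<^sub>m n) = (1\<^sub>m n :: complex mat)"
  by (intro eq_matI) auto

text \<open>A pair \<open>(a, b)\<close> is encoded as the index \<open>a * n + b\<close>:
  \<open>sum.nat_group\<close> cuts the range into \<open>m\<close> blocks of length
  \<open>n\<close>, and each block is shifted down to \<open>{..<n}\<close>. Sums over indices of a
  Kronecker product become double sums this way.\<close>

lemma sum_div_mod:
  fixes f :: "nat \<Rightarrow> nat \<Rightarrow> 'a::comm_monoid_add"
  shows "(\<Sum>k<m * n. f (k div n) (k mod n)) = (\<Sum>a<m. \<Sum>b<n. f a b)"
proof -
  have "(\<Sum>k<m * n. f (k div n) (k mod n)) = (\<Sum>a<m. \<Sum>k\<in>{a * n..<a * n + n}. f (k div n) (k mod n))"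
    by (rule sum.nat_group[symmetric])
  also have "\<dots> = (\<Sum>a<m. \<Sum>b<n. f a b)"
  proof (rule sum.cong[OF refl])
    fix a
    have "(\<Sum>k\<in>{a * n..<a * n + n}. f (k div n) (k mod n)) = (\<Sum>b\<in>{0..<n}. f ((b + a * n) div n) ((b + a * n) mod n))"
      using sum.shift_bounds_nat_ivl[of "\<lambda>k. f (k div n) (k mod n)" 0 "a * n" n]
      by (simp only: add_0 add.commute)
    also have "\<dots> = (\<Sum>b<n. f a b)" by (auto simp: lessThan_atLeast0 intro!: sum.cong)
    finally show "(\<Sum>k\<in>{a * n..<a * n + n}. f (k div n) (k mod n)) = (\<Sum>b<n. f a b)" .
  qed
  finally show ?thesis .
qed

lemma kronecker_dim [simp]:
  "dim_row (kronecker A B) = dim_row A * dim_row B" "dim_col (kronecker A B) = dim_col A * dim_col B"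
  by (simp_all add: kronecker_def)

lemma kronecker_carrier [simp, intro]:
  "A \<in> carrier_mat m n \<Longrightarrow> B \<in> carrier_mat p q \<Longrightarrow> kronecker A B \<in> carrier_mat (m * p) (n * q)"
  by (intro carrier_matI) (simp_all only: kronecker_dim carrier_matD)

lemma kronecker_index [simp]:
  assumes "i < dim_row A * dim_row B" "j < dim_col A * dim_col B"
  shows "kronecker A B $$ (i, j) =
     A $$ (i div dim_row B, j div dim_col B) * B $$ (i mod dim_row B, j mod dim_col B)"
  using assms by (simp add: kronecker_def)

lemma div_mod_less:
  assumes "(i::nat) < m * n" shows "i div n < m" "i mod n < n"
  using assms by (cases n; simp add: less_mult_imp_div_less)+

lemma kronecker_mult:
  assumes "A \<in> carrier_mat m n" "C \<in> carrier_mat n p" "B \<in> carrier_mat m' n'" "D \<in> carrier_mat n' p'"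
  shows "kronecker A B * kronecker C D = kronecker (A * C) (B * D)"
proof (rule eq_matI)
  fix i j assume "i < dim_row (kronecker (A * C) (B * D))" "j < dim_col (kronecker (A * C) (B * D))"
  hence ij: "i < m * m'" "j < p * p'" using assms by auto
  note dm = div_mod_less[OF ij(1)] div_mod_less[OF ij(2)]
  have "(kronecker A B * kronecker C D) $$ (i, j) =
      (\<Sum>k<n * n'. A $$ (i div m', k div n') * B $$ (i mod m', k mod n') *
                    (C $$ (k div n', j div p') * D $$ (k mod n', j mod p')))"
    using ij assms by (auto simp: scalar_prod_def lessThan_atLeast0 intro!: sum.cong)
  also have "\<dots> = (\<Sum>a<n. \<Sum>b<n'. A $$ (i div m', a) * B $$ (i mod m', b) *
                    (C $$ (a, j div p') * D $$ (b, j mod p')))"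
    by (rule sum_div_mod)
  also have "\<dots> = (\<Sum>a<n. A $$ (i div m', a) * C $$ (a, j div p')) * (\<Sum>b<n'. B $$ (i mod m', b) * D $$ (b, j mod p'))"
    by (simp add: sum_product algebra_simps)
  also have "\<dots> = kronecker (A * C) (B * D) $$ (i, j)"
    using ij assms dm by (auto simp: scalar_prod_def lessThan_atLeast0)
  finally show "(kronecker A B * kronecker C D) $$ (i, j) = kronecker (A * C) (B * D) $$ (i, j)" .
qed (use assms in auto)

lemma kronecker_adjoint:
  "mat_adjoint (kronecker A B) = kronecker (mat_adjoint A) (mat_adjoint B)"
proof (rule eq_matI)
  fix i j assume "i < dim_row (kronecker (mat_adjoint A) (mat_adjoint B))"
    "j < dim_col (kronecker (mat_adjoint A) (mat_adjoint B))"
  hence "i < dim_col A * dim_col B" "j < dim_row A * dim_row B" by auto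
  thus "mat_adjoint (kronecker A B) $$ (i, j) = kronecker (mat_adjoint A) (mat_adjoint B) $$ (i, j)"
    by (simp add: div_mod_less[of i] div_mod_less[of j])
qed auto

lemma kronecker_smult: "kronecker (c \<cdot>\<^sub>m A) (d \<cdot>\<^sub>m B) = (c * d) \<cdot>\<^sub>m kronecker A B"
proof (rule eq_matI)
  fix i j assume "i < dim_row ((c * d) \<cdot>\<^sub>m kronecker A B)" "j < dim_col ((c * d) \<cdot>\<^sub>m kronecker A B)"
  hence "i < dim_row A * dim_row B" "j < dim_col A * dim_col B" by auto
  thus "kronecker (c \<cdot>\<^sub>m A) (d \<cdot>\<^sub>m B) $$ (i, j) = ((c * d) \<cdot>\<^sub>m kronecker A B) $$ (i, j)"
    by (simp add: div_mod_less[of i] div_mod_less[of j])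
qed auto

lemma kronecker_one: "kronecker (1\<^sub>m m) (1\<^sub>m n) = 1\<^sub>m (m * n)"
proof (rule eq_matI)
  fix i j assume "i < dim_row (1\<^sub>m (m * n) :: complex mat)" "j < dim_col (1\<^sub>m (m * n) :: complex mat)"
  hence ij: "i < m * n" "j < m * n" by auto
  have "i = j \<longleftrightarrow> i div n = j div n \<and> i mod n = j mod n"
    by (metis div_mult_mod_eq)
  thus "kronecker (1\<^sub>m m) (1\<^sub>m n) $$ (i, j) = 1\<^sub>m (m * n) $$ (i, j)"
    using ij div_mod_less[OF ij(1)] div_mod_less[OF ij(2)] by auto
qed auto

lemma kronecker_one_1 [simp]: "kronecker A (1\<^sub>m 1) = A"
  by (intro eq_matI) auto

section \<open>Fourth roots of unity as phases\<close>

definition phases :: "complex set" where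
  "phases = {1, - 1, \<i>, - \<i>}"

lemma phases_mult: "c \<in> phases \<Longrightarrow> d \<in> phases \<Longrightarrow> c * d \<in> phases"
  by (auto simp: phases_def)

lemma phases_cnj: "c \<in> phases \<Longrightarrow> cnj c \<in> phases"
  by (auto simp: phases_def)

lemma phases_cnj_mult: "c \<in> phases \<Longrightarrow> c * cnj c = 1" "c \<in> phases \<Longrightarrow> cnj c * c = 1"
  by (auto simp: phases_def)

lemma phases_nz: "c \<in> phases \<Longrightarrow> c \<noteq> 0"
  by (auto simp: phases_def)

lemma phases_1 [simp]: "1 \<in> phases" "-1 \<in> phases"
  by (auto simp: phases_def)

text \<open>Such a \<open>c\<close> is a root of \<open>c^4 - 1\<close>, which splits into the four
  linear factors. This identifies the unknown scalar of a multiple of a Pauli operator from its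
  square.\<close>

lemma phasesI_square:
  assumes "c * c = 1 \<or> c * c = (-1 :: complex)"
  shows "c \<in> phases"
proof -
  have "(c - 1) * (c + 1) * ((c - \<i>) * (c + \<i>)) = (c * c - 1) * (c * c + 1)"
    by (simp add: algebra_simps)
  also have "\<dots> = 0" using assms by auto
  finally show ?thesis by (auto simp: phases_def eq_neg_iff_add_eq_0)
qed

subsection \<open>Pauli operators indexed by symplectic labels\<close>

text \<open>The label \<open>(a, b)\<close> stands for \<open>X\<^sup>a Z\<^sup>b\<close> up to a phase, chosen to make the operator Hermitian.\<close>

definition pauli1 :: "bool \<times> bool \<Rightarrow> complex mat" where
  "pauli1 p = (case p of (a, b) \<Rightarrow>
     if a then if b then pauli_Y else pauli_X else if b then pauli_Z else pauli_I)"

definition pauli_op :: "(bool \<times> bool) list \<Rightarrow> complex mat" where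
  "pauli_op vs = tensor_list (map pauli1 vs)"

definition xor1 :: "bool \<times> bool \<Rightarrow> bool \<times> bool \<Rightarrow> bool \<times> bool" where
  "xor1 p q = (fst p \<noteq> fst q, snd p \<noteq> snd q)"

text \<open>The symplectic form on pairs of bits, written multiplicatively: \<open>-1\<close> to the
  power \<open>a b' + b a'\<close>, which is the commutation sign of two Pauli matrices.\<close>

definition sign1 :: "bool \<times> bool \<Rightarrow> bool \<times> bool \<Rightarrow> complex" where
  "sign1 p q = (if (fst p \<and> snd q) \<noteq> (snd p \<and> fst q) then - 1 else 1)"

text \<open>Addition in the label space over the field with two elements. The last equation serves
  the empty lists and truncates lists of unequal length.\<close>

fun lxor :: "(bool \<times> bool) list \<Rightarrow> (bool \<times> bool) list \<Rightarrow> (bool \<times> bool) list" where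
  "lxor (p # v) (q # w) = xor1 p q # lxor v w"
| "lxor _ _ = []"

fun comm_sign :: "(bool \<times> bool) list \<Rightarrow> (bool \<times> bool) list \<Rightarrow> complex" where
  "comm_sign (p # v) (q # w) = sign1 p q * comm_sign v w"
| "comm_sign _ _ = 1"

abbreviation zlab :: "nat \<Rightarrow> (bool \<times> bool) list" where
  "zlab n \<equiv> replicate n (False, False)"

lemma pauli1_carrier [simp]: "pauli1 p \<in> carrier_mat 2 2"
  by (auto simp: pauli1_def pauli_X_def pauli_Y_def pauli_Z_def pauli_I_def mat_of_rows_list_def
      split: prod.splits)

lemma pauli1_dim [simp]: "dim_row (pauli1 p) = 2" "dim_col (pauli1 p) = 2"
  using pauli1_carrier[of p] by (auto simp del: pauli1_carrier)

lemma less_2_cases': "(i::nat) < 2 \<longleftrightarrow> i = 0 \<or> i = 1"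
  by auto

lemma pauli1_index:
  "pauli1 (False, False) $$ (0, 0) = 1" "pauli1 (False, False) $$ (0, Suc 0) = 0"
  "pauli1 (False, False) $$ (Suc 0, 0) = 0" "pauli1 (False, False) $$ (Suc 0, Suc 0) = 1"
  "pauli1 (True, False) $$ (0, 0) = 0" "pauli1 (True, False) $$ (0, Suc 0) = 1"
  "pauli1 (True, False) $$ (Suc 0, 0) = 1" "pauli1 (True, False) $$ (Suc 0, Suc 0) = 0"
  "pauli1 (False, True) $$ (0, 0) = 1" "pauli1 (False, True) $$ (0, Suc 0) = 0"
  "pauli1 (False, True) $$ (Suc 0, 0) = 0" "pauli1 (False, True) $$ (Suc 0, Suc 0) = -1"
  "pauli1 (True, True) $$ (0, 0) = 0" "pauli1 (True, True) $$ (0, Suc 0) = -\<i>"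
  "pauli1 (True, True) $$ (Suc 0, 0) = \<i>" "pauli1 (True, True) $$ (Suc 0, Suc 0) = 0"
  by (simp_all add: pauli1_def pauli_X_def pauli_Y_def pauli_Z_def pauli_I_def mat_of_rows_list_def)

lemma pauli1_adjoint: "mat_adjoint (pauli1 p) = pauli1 p"
proof (rule eq_matI)
  fix i j assume "i < dim_row (pauli1 p)" "j < dim_col (pauli1 p)"
  thus "mat_adjoint (pauli1 p) $$ (i, j) = pauli1 p $$ (i, j)"
    by (cases p rule: prod.exhaust; cases "fst p"; cases "snd p")
      (auto simp: less_2_cases' pauli1_index)
qed auto

lemma mat2_eqI:
  assumes "A \<in> carrier_mat 2 2" "B \<in> carrier_mat 2 2"
    and "A $$ (0, 0) = B $$ (0, 0)" "A $$ (0, Suc 0) = B $$ (0, Suc 0)"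
    and "A $$ (Suc 0, 0) = B $$ (Suc 0, 0)" "A $$ (Suc 0, Suc 0) = B $$ (Suc 0, Suc 0)"
  shows "A = B"
proof (rule eq_matI)
  fix i j assume "i < dim_row B" "j < dim_col B"
  hence "i = 0 \<or> i = Suc 0" "j = 0 \<or> j = Suc 0" using assms(2) by auto
  thus "A $$ (i, j) = B $$ (i, j)" using assms by auto
qed (use assms in auto)

lemma pauli1_mult_index:
  assumes "i < 2" "j < 2"
  shows "(pauli1 p * pauli1 q) $$ (i, j) =
    pauli1 p $$ (i, 0) * pauli1 q $$ (0, j) + pauli1 p $$ (i, Suc 0) * pauli1 q $$ (Suc 0, j)"
  using assms by (simp add: scalar_prod_def numeral_2_eq_2)

lemma pauli1_mult: "\<exists>c\<in>phases. pauli1 p * pauli1 q = c \<cdot>\<^sub>m pauli1 (xor1 p q)"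
proof -
  obtain a b where p: "p = (a, b)" by force
  obtain a' b' where q: "q = (a', b')" by force
  \<comment> \<open>Entrywise form of the equation, so that the phase can be found by trying the
    four candidates in each of the sixteen cases.\<close>
  have eq: "pauli1 p * pauli1 q = c \<cdot>\<^sub>m pauli1 (xor1 p q) \<longleftrightarrow>
     (\<forall>i\<in>{0, Suc 0}. \<forall>j\<in>{0, Suc 0}. (pauli1 p * pauli1 q) $$ (i, j) = c * pauli1 (xor1 p q) $$ (i, j))"
    (is "?l \<longleftrightarrow> ?r") for c
  proof
    show "?r \<Longrightarrow> ?l"
      by (rule mat2_eqI) (use mult_carrier_mat[OF pauli1_carrier pauli1_carrier] in auto)
  qed auto
  show ?thesis
    unfolding phases_def eq unfolding p q
    by (cases a; cases b; cases a'; cases b') (simp_all add: xor1_def pauli1_mult_index pauli1_index del: index_mult_mat(1))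
qed

lemma pauli1_comm: "pauli1 p * pauli1 q = sign1 p q \<cdot>\<^sub>m (pauli1 q * pauli1 p)"
proof -
  obtain a b where p: "p = (a, b)" by force
  obtain a' b' where q: "q = (a', b')" by force
  show ?thesis unfolding p q
    by (rule mat2_eqI; cases a; cases b; cases a'; cases b')
      (simp_all add: sign1_def pauli1_mult_index pauli1_index mult_carrier_mat[OF pauli1_carrier pauli1_carrier] del: index_mult_mat(1))
qed

lemma pauli1_square: "pauli1 p * pauli1 p = 1\<^sub>m 2"
proof -
  obtain a b where p: "p = (a, b)" by force
  show ?thesis unfolding p
    by (rule mat2_eqI; cases a; cases b)
      (simp_all add: pauli1_mult_index pauli1_index mult_carrier_mat[OF pauli1_carrier pauli1_carrier] del: index_mult_mat(1))
qed

lemma pauli_op_simps [simp]: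
  "pauli_op [] = 1\<^sub>m 1" "pauli_op (p # v) = kronecker (pauli1 p) (pauli_op v)"
  by (simp_all add: pauli_op_def tensor_list_def)

lemma pauli_op_carrier: "pauli_op v \<in> carrier_mat (2 ^ length v) (2 ^ length v)"
  by (induction v) (auto intro: kronecker_carrier[OF pauli1_carrier])

lemma pauli_op_carrier' [simp]: "length v = n \<Longrightarrow> pauli_op v \<in> carrier_mat (2 ^ n) (2 ^ n)"
  using pauli_op_carrier by blast

lemma pauli_op_adjoint: "mat_adjoint (pauli_op v) = pauli_op v"
  by (induction v) (simp_all add: kronecker_adjoint pauli1_adjoint)

lemma pauli_op_square: "pauli_op v * pauli_op v = 1\<^sub>m (2 ^ length v)"
proof (induction v)
  case (Cons p v)
  show ?case
    by (simp add: kronecker_mult[OF pauli1_carrier pauli1_carrier pauli_op_carrier pauli_op_carrier]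
        pauli1_square Cons kronecker_one)
qed simp

lemma lxor_length [simp]: "length v = length w \<Longrightarrow> length (lxor v w) = length w"
  by (induction v w rule: list_induct2) auto

lemma pauli_op_mult:
  "length v = length w \<Longrightarrow> \<exists>c\<in>phases. pauli_op v * pauli_op w = c \<cdot>\<^sub>m pauli_op (lxor v w)"
proof (induction v w rule: list_induct2)
  case Nil
  show ?case by (intro bexI[of _ 1]) auto
next
  case (Cons p v q w)
  then obtain c where c: "c \<in> phases" "pauli_op v * pauli_op w = c \<cdot>\<^sub>m pauli_op (lxor v w)" by blast
  obtain d where d: "d \<in> phases" "pauli1 p * pauli1 q = d \<cdot>\<^sub>m pauli1 (xor1 p q)"
    using pauli1_mult by blast
  have "pauli_op v \<in> carrier_mat (2 ^ length w) (2 ^ length w)" using Cons.hyps by simp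
  hence "pauli_op (p # v) * pauli_op (q # w) = (d * c) \<cdot>\<^sub>m pauli_op (lxor (p # v) (q # w))"
    by (simp add: kronecker_mult[OF pauli1_carrier pauli1_carrier _ pauli_op_carrier] c d kronecker_smult)
  thus ?case using phases_mult[OF d(1) c(1)] by blast
qed

lemma pauli_op_comm:
  "length v = length w \<Longrightarrow> pauli_op v * pauli_op w = comm_sign v w \<cdot>\<^sub>m (pauli_op w * pauli_op v)"
proof (induction v w rule: list_induct2)
  case Nil
  show ?case by (intro eq_matI) auto
next
  case (Cons p v q w)
  have vc: "pauli_op v \<in> carrier_mat (2 ^ length w) (2 ^ length w)" using Cons.hyps by simp
  show ?case
    using vc kronecker_mult[OF pauli1_carrier pauli1_carrier vc pauli_op_carrier]
      kronecker_mult[OF pauli1_carrier pauli1_carrier pauli_op_carrier vc]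
    by (simp add: Cons.IH pauli1_comm[of p q] kronecker_smult del: pauli_op_carrier')
qed

lemma comm_sign_cases: "comm_sign v w = 1 \<or> comm_sign v w = -1"
  by (induction v w rule: comm_sign.induct) (auto simp: sign1_def)

lemma comm_sign_sym: "comm_sign v w = comm_sign w v"
  by (induction v w rule: comm_sign.induct) (auto simp: sign1_def)

lemma comm_sign_self [simp]: "comm_sign v v = 1"
  by (induction v) (auto simp: sign1_def)

lemma comm_sign_zero [simp]: "comm_sign (zlab n) w = 1" "comm_sign w (zlab n) = 1"
  by (induction w arbitrary: n, auto simp: sign1_def gr0_conv_Suc split: nat.split)
     (case_tac n; auto simp: sign1_def)+

lemma comm_sign_lxor:
  "length u = length v \<Longrightarrow> length v = length w \<Longrightarrow>
     comm_sign (lxor u v) w = comm_sign u w * comm_sign v w"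
  by (induction u v w rule: list_induct3) (auto simp: sign1_def xor1_def)

text \<open>Nondegeneracy of the symplectic form: a factor other than the identity anticommutes with
  some Pauli matrix, and this matrix is placed at that factor with identities elsewhere.\<close>

lemma comm_sign_nondegenerate:
  "v \<noteq> zlab (length v) \<Longrightarrow> \<exists>u. length u = length v \<and> comm_sign v u = -1"
proof (induction v)
  case (Cons p v)
  show ?case
  proof (cases "p = (False, False)")
    case True
    with Cons obtain u where "length u = length v" "comm_sign v u = -1" by auto
    thus ?thesis using True by (intro exI[of _ "(False, False) # u"]) (auto simp: sign1_def)
  next
    case False
    then obtain q where "sign1 p q = -1"
      by (cases p; cases "fst p"; cases "snd p") (auto simp: sign1_def)
    thus ?thesis by (intro exI[of _ "q # zlab (length v)"]) auto
  qed
qed auto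

lemma lxor_zero [simp]: "length v = n \<Longrightarrow> lxor (zlab n) v = v" "length v = n \<Longrightarrow> lxor v (zlab n) = v"
  by (induction v arbitrary: n) (auto simp: xor1_def)

lemma lxor_self [simp]: "lxor v v = zlab (length v)"
  by (induction v) (auto simp: xor1_def)

lemma lxor_commute: "length v = length w \<Longrightarrow> lxor v w = lxor w v"
  by (induction v w rule: list_induct2) (auto simp: xor1_def)

lemma lxor_cancel: "length v = length w \<Longrightarrow> lxor v (lxor v w) = w"
  by (induction v w rule: list_induct2) (auto simp: xor1_def)

lemma lxor_cancel': "length v = length w \<Longrightarrow> lxor (lxor v w) w = v"
  by (induction v w rule: list_induct2) (auto simp: xor1_def)

lemma pauli_op_zero: "pauli_op (zlab n) = 1\<^sub>m (2 ^ n)"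
proof (induction n)
  case (Suc n)
  have "pauli1 (False, False) = 1\<^sub>m 2" by (simp add: pauli1_def pauli_I_def)
  thus ?case using Suc kronecker_one[of 2 "2 ^ n"] by simp
qed simp

text \<open>\<open>pauli1\<close> reaches all four Pauli matrices, so labels can be recovered letter
  by letter with \<open>inv_into\<close>.\<close>

lemma pauli_set_eq: "pauli_set n = {c \<cdot>\<^sub>m pauli_op v | c v. c \<in> phases \<and> length v = n}"
proof -
  have range: "{pauli_I, pauli_X, pauli_Y, pauli_Z} = range pauli1"
  proof (intro equalityI subsetI)
    fix A assume "A \<in> {pauli_I, pauli_X, pauli_Y, pauli_Z}"
    hence "A \<in> pauli1 ` {(False, False), (True, False), (True, True), (False, True)}"
      by (auto simp: pauli1_def)
    thus "A \<in> range pauli1" by blast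
  qed (auto simp: pauli1_def)
  have ex: "(\<exists>v. ps = map pauli1 v \<and> length v = n) \<longleftrightarrow> length ps = n \<and> set ps \<subseteq> range pauli1" for ps
  proof
    assume *: "length ps = n \<and> set ps \<subseteq> range pauli1"
    hence "map pauli1 (map (inv_into UNIV pauli1) ps) = ps"
      by (auto simp: f_inv_into_f subset_iff intro!: map_idI)
    thus "\<exists>v. ps = map pauli1 v \<and> length v = n" using * by (metis length_map)
  qed auto
  show ?thesis unfolding pauli_set_def range pauli_op_def phases_def[symmetric]
    unfolding ex[symmetric] by blast
qed

subsection \<open>Maximal abelian subgroups of the Pauli group\<close>

lemma mat_sq_mult [simp]:
  "A \<in> carrier_mat N N \<Longrightarrow> B \<in> carrier_mat N N \<Longrightarrow> A * B \<in> carrier_mat N N"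
  by (rule mult_carrier_mat)

lemma mat_assoc:
  fixes A B C :: "complex mat"
  shows "A \<in> carrier_mat N N \<Longrightarrow> B \<in> carrier_mat N N \<Longrightarrow> C \<in> carrier_mat N N \<Longrightarrow> A * B * C = A * (B * C)"
  by (rule assoc_mult_mat)

lemma smult_smult: "a \<cdot>\<^sub>m (b \<cdot>\<^sub>m A) = (a * b) \<cdot>\<^sub>m (A :: complex mat)"
  by (intro eq_matI) auto

lemma one_smult: "1 \<cdot>\<^sub>m A = (A :: complex mat)"
  by (intro eq_matI) auto

lemma smult_mult:
  fixes A B :: "complex mat"
  assumes "A \<in> carrier_mat N N" "B \<in> carrier_mat N N"
  shows "(a \<cdot>\<^sub>m A) * B = a \<cdot>\<^sub>m (A * B)" "A * (b \<cdot>\<^sub>m B) = b \<cdot>\<^sub>m (A * B)"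
    "(a \<cdot>\<^sub>m A) * (b \<cdot>\<^sub>m B) = (a * b) \<cdot>\<^sub>m (A * B)"
proof -
  show *: "(a \<cdot>\<^sub>m A) * B = a \<cdot>\<^sub>m (A * B)" for a using mult_smult_assoc_mat assms by blast
  show **: "A * (b \<cdot>\<^sub>m B) = b \<cdot>\<^sub>m (A * B)" for b using mult_smult_distrib assms by blast
  show "(a \<cdot>\<^sub>m A) * (b \<cdot>\<^sub>m B) = (a * b) \<cdot>\<^sub>m (A * B)" 
    using mult_smult_assoc_mat[of A N N "b \<cdot>\<^sub>m B" N a] ** assms by (simp add: smult_smult)
qed

section \<open>Unitary gates and conjugation by them\<close>

lemma unitary_gateD:
  assumes "unitary_gate n U"
  shows "U \<in> carrier_mat (2 ^ n) (2 ^ n)" "mat_adjoint U \<in> carrier_mat (2 ^ n) (2 ^ n)"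
    "U * mat_adjoint U = 1\<^sub>m (2 ^ n)" "mat_adjoint U * U = 1\<^sub>m (2 ^ n)"
  using assms by (auto simp: unitary_gate_def)

lemma unitary_gate_mult:
  assumes "unitary_gate n U" "unitary_gate n V"
  shows "unitary_gate n (U * V)"
proof -
  note u = unitary_gateD[OF assms(1)] and v = unitary_gateD[OF assms(2)]
  have "U * V * (mat_adjoint V * mat_adjoint U) = U * (V * mat_adjoint V) * mat_adjoint U"
    using u(1,2) v(1,2) by (simp add: mat_assoc[of _ "2 ^ n"])
  moreover have "mat_adjoint V * mat_adjoint U * (U * V) = mat_adjoint V * (mat_adjoint U * U) * V"
    using u(1,2) v(1,2) by (simp add: mat_assoc[of _ "2 ^ n"])
  ultimately show ?thesis using u v unfolding unitary_gate_def
    by (simp add: mat_adjoint_mult[OF u(1) v(1)])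
qed

lemma unitary_gate_adjoint: "unitary_gate n U \<Longrightarrow> unitary_gate n (mat_adjoint U)"
  by (auto simp: unitary_gate_def)

lemma unitary_gate_smult:
  assumes "unitary_gate n U" "c * cnj c = 1"
  shows "unitary_gate n (c \<cdot>\<^sub>m U)"
proof -
  note u = unitary_gateD[OF assms(1)]
  have "c \<cdot>\<^sub>m U * (cnj c \<cdot>\<^sub>m mat_adjoint U) = 1\<^sub>m (2 ^ n)" "cnj c \<cdot>\<^sub>m mat_adjoint U * (c \<cdot>\<^sub>m U) = 1\<^sub>m (2 ^ n)"
    using u assms(2) by (simp_all add: smult_mult[of _ "2 ^ n"] one_smult smult_smult mult.commute)
  thus ?thesis using u by (simp add: unitary_gate_def mat_adjoint_smult)
qed

lemma unitary_pauli_op: "length v = n \<Longrightarrow> unitary_gate n (pauli_op v)"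
  using pauli_op_square[of v] by (auto simp: unitary_gate_def pauli_op_adjoint)

lemma conj_by_carrier [simp]:
  "unitary_gate n U \<Longrightarrow> A \<in> carrier_mat (2 ^ n) (2 ^ n) \<Longrightarrow> conj_by U A \<in> carrier_mat (2 ^ n) (2 ^ n)"
  using unitary_gateD by (fastforce simp: conj_by_def)

lemma conj_by_mult:
  assumes "unitary_gate n U" "A \<in> carrier_mat (2 ^ n) (2 ^ n)" "B \<in> carrier_mat (2 ^ n) (2 ^ n)"
  shows "conj_by U (A * B) = conj_by U A * conj_by U B"
proof -
  note u = unitary_gateD[OF assms(1)]
  have "conj_by U A * conj_by U B = U * A * (mat_adjoint U * U) * B * mat_adjoint U"
    unfolding conj_by_def using u(1,2) assms(2,3)
    by (simp add: mat_assoc[of _ "2 ^ n"])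
  also have "\<dots> = conj_by U (A * B)"
    unfolding conj_by_def u(4) using u(1,2) assms(2,3)
    by (simp add: mat_assoc[of _ "2 ^ n"])
  finally show ?thesis ..
qed

lemma conj_by_smult:
  assumes "unitary_gate n U" "A \<in> carrier_mat (2 ^ n) (2 ^ n)"
  shows "conj_by U (c \<cdot>\<^sub>m A) = c \<cdot>\<^sub>m conj_by U A"
proof -
  note u = unitary_gateD[OF assms(1)]
  have "U * A \<in> carrier_mat (2 ^ n) (2 ^ n)" using u assms by auto
  thus ?thesis using u assms unfolding conj_by_def by (simp add: smult_mult[of _ "2 ^ n"])
qed

lemma conj_by_one: "unitary_gate n U \<Longrightarrow> conj_by U (1\<^sub>m (2 ^ n)) = 1\<^sub>m (2 ^ n)"
  using unitary_gateD[of n U] by (simp add: conj_by_def)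

lemma conj_by_comp:
  assumes "unitary_gate n U" "unitary_gate n V" "A \<in> carrier_mat (2 ^ n) (2 ^ n)"
  shows "conj_by U (conj_by V A) = conj_by (U * V) A"
proof -
  note u = unitary_gateD[OF assms(1)] and v = unitary_gateD[OF assms(2)]
  show ?thesis unfolding conj_by_def mat_adjoint_mult[OF u(1) v(1)] using u(1,2) v(1,2) assms(3)
    by (simp add: mat_assoc[of _ "2 ^ n"])
qed

lemma conj_by_cancel:
  assumes "unitary_gate n U" "A \<in> carrier_mat (2 ^ n) (2 ^ n)"
  shows "conj_by (mat_adjoint U) (conj_by U A) = A"
  using assms unitary_gateD[OF assms(1)] unitary_gate_adjoint[OF assms(1)]
  by (subst conj_by_comp[of n]) (auto simp: conj_by_def)

text \<open>Multiplying by the adjoint leaves two multiples of the identity, whose top left entries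
  are compared.\<close>

lemma unitary_nonzero:
  assumes "unitary_gate n A" "a \<cdot>\<^sub>m A = b \<cdot>\<^sub>m A"
  shows "a = b"
proof -
  note u = unitary_gateD[OF assms(1)]
  have "a \<cdot>\<^sub>m 1\<^sub>m (2 ^ n) = (a \<cdot>\<^sub>m A) * mat_adjoint A" using u by (simp add: smult_mult[of _ "2 ^ n"])
  also have "\<dots> = b \<cdot>\<^sub>m 1\<^sub>m (2 ^ n)" unfolding assms(2) using u by (simp add: smult_mult[of _ "2 ^ n"])
  finally have "(a \<cdot>\<^sub>m 1\<^sub>m (2 ^ n)) $$ (0, 0) = (b \<cdot>\<^sub>m (1\<^sub>m (2 ^ n) :: complex mat)) $$ (0, 0)" by simp
  thus ?thesis by simp
qed

lemma comm_sign_eq_1_iff: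
  assumes "length v = n" "length w = n"
  shows "pauli_op v * pauli_op w = pauli_op w * pauli_op v \<longleftrightarrow> comm_sign v w = 1"
proof
  assume "pauli_op v * pauli_op w = pauli_op w * pauli_op v"
  hence "1 \<cdot>\<^sub>m (pauli_op w * pauli_op v) = comm_sign v w \<cdot>\<^sub>m (pauli_op w * pauli_op v)"
    using pauli_op_comm[of v w] assms by (simp add: one_smult)
  thus "comm_sign v w = 1"
    using unitary_nonzero unitary_gate_mult[OF unitary_pauli_op[OF assms(2)] unitary_pauli_op[OF assms(1)]]
    by metis
next
  assume "comm_sign v w = 1"
  thus "pauli_op v * pauli_op w = pauli_op w * pauli_op v"
    using pauli_op_comm[of v w] assms by (simp add: one_smult)
qed

text \<open>Conjugation is multiplicative, so commuting operators have commuting images; the phases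
  are nonzero and cancel.\<close>

lemma comm_sign_conj:
  assumes "unitary_gate n U" "length v = n" "length w = n" "length v' = n" "length w' = n"
    and "c \<in> phases" "d \<in> phases"
    and "conj_by U (pauli_op v) = c \<cdot>\<^sub>m pauli_op v'" "conj_by U (pauli_op w) = d \<cdot>\<^sub>m pauli_op w'"
    and "comm_sign v w = 1"
  shows "comm_sign v' w' = 1"
proof -
  have "conj_by U (pauli_op v * pauli_op w) = conj_by U (pauli_op w * pauli_op v)"
    using comm_sign_eq_1_iff[OF assms(2,3)] assms(10) by simp
  hence "(c \<cdot>\<^sub>m pauli_op v') * (d \<cdot>\<^sub>m pauli_op w') = (d \<cdot>\<^sub>m pauli_op w') * (c \<cdot>\<^sub>m pauli_op v')"
    using assms by (simp add: conj_by_mult)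
  hence "(c * d) \<cdot>\<^sub>m (pauli_op v' * pauli_op w') = (c * d) \<cdot>\<^sub>m (pauli_op w' * pauli_op v')"
    using assms by (simp add: smult_mult[of _ "2 ^ n"] smult_smult mult.commute)
  hence "(inverse (c * d) * (c * d)) \<cdot>\<^sub>m (pauli_op v' * pauli_op w') = (inverse (c * d) * (c * d)) \<cdot>\<^sub>m (pauli_op w' * pauli_op v')"
    unfolding smult_smult[symmetric] by simp
  hence "pauli_op v' * pauli_op w' = pauli_op w' * pauli_op v'"
    using phases_nz[OF assms(6)] phases_nz[OF assms(7)]
    by (simp only: left_inverse mult_eq_0_iff one_smult simp_thms)
  thus ?thesis using comm_sign_eq_1_iff[of v' n w'] assms by simp
qed

text \<open>A scalar commutes with every operator, whereas by nondegeneracy any other label has an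
  anticommuting partner.\<close>

lemma scalar_pauli_op:
  assumes "pauli_op v = c \<cdot>\<^sub>m 1\<^sub>m (2 ^ n)" "length v = n"
  shows "v = zlab n"
proof (rule ccontr)
  assume "v \<noteq> zlab n"
  then obtain u where u: "length u = n" "comm_sign v u = -1"
    using comm_sign_nondegenerate[of v] assms(2) by auto
  have "pauli_op v * pauli_op u = pauli_op u * pauli_op v"
    unfolding assms(1) using pauli_op_carrier'[OF u(1)]
    by (simp add: smult_mult[of _ "2 ^ n"])
  thus False using comm_sign_eq_1_iff[OF assms(2) u(1)] u(2) by simp
qed

lemma conj_scalar_pauli_op:
  assumes "unitary_gate n U" "conj_by U (pauli_op v) = c \<cdot>\<^sub>m 1\<^sub>m (2 ^ n)" "length v = n"
  shows "v = zlab n"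
proof -
  have "pauli_op v = conj_by (mat_adjoint U) (c \<cdot>\<^sub>m 1\<^sub>m (2 ^ n))"
    using conj_by_cancel[OF assms(1) pauli_op_carrier'[OF assms(3)]] assms(2) by simp
  also have "\<dots> = c \<cdot>\<^sub>m 1\<^sub>m (2 ^ n)"
    using unitary_gate_adjoint[OF assms(1)] by (simp add: conj_by_smult conj_by_one)
  finally show ?thesis using scalar_pauli_op assms(3) by blast
qed

section \<open>The Pauli group as a group\<close>

lemma pauli_group_simps [simp]:
  "carrier (pauli_group n) = pauli_set n" "monoid.mult (pauli_group n) = (*)"
  "one (pauli_group n) = 1\<^sub>m (2 ^ n)"
  by (simp_all add: pauli_group_def)

lemma pauli_setI: "c \<in> phases \<Longrightarrow> length v = n \<Longrightarrow> c \<cdot>\<^sub>m pauli_op v \<in> pauli_set n"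
  by (auto simp: pauli_set_eq)

lemma pauli_setE:
  assumes "A \<in> pauli_set n"
  obtains c v where "c \<in> phases" "length v = n" "A = c \<cdot>\<^sub>m pauli_op v"
  using assms by (auto simp: pauli_set_eq)

lemma phase_pauli_mult:
  assumes "c \<in> phases" "d \<in> phases" "length v = n" "length w = n"
  shows "\<exists>e\<in>phases. (c \<cdot>\<^sub>m pauli_op v) * (d \<cdot>\<^sub>m pauli_op w) = e \<cdot>\<^sub>m pauli_op (lxor v w)"
proof -
  obtain e where e: "e \<in> phases" "pauli_op v * pauli_op w = e \<cdot>\<^sub>m pauli_op (lxor v w)"
    using pauli_op_mult[of v w] assms by auto
  show ?thesis using assms e phases_mult
    by (intro bexI[of _ "c * d * e"]) (auto simp: smult_mult[of _ "2 ^ n"] smult_smult)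
qed

lemma phase_pauli_inverse:
  assumes "c \<in> phases" "length v = n"
  shows "(cnj c \<cdot>\<^sub>m pauli_op v) * (c \<cdot>\<^sub>m pauli_op v) = 1\<^sub>m (2 ^ n)"
  using assms pauli_op_square[of v] by (simp add: smult_mult[of _ "2 ^ n"] smult_smult phases_cnj_mult one_smult)

lemma group_pauli_group: "group (pauli_group n)"
proof (rule groupI; simp only: pauli_group_simps)
  show "A * B \<in> pauli_set n" if "A \<in> pauli_set n" "B \<in> pauli_set n" for A B
    using that phase_pauli_mult pauli_setI by (metis pauli_setE lxor_length)
  show "1\<^sub>m (2 ^ n) \<in> pauli_set n"
    using pauli_setI[of 1 "zlab n" n] by (simp add: pauli_op_zero one_smult)
  show "A * B * C = A * (B * C)" if "A \<in> pauli_set n" "B \<in> pauli_set n" "C \<in> pauli_set n" for A B C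
  proof -
    have "X \<in> carrier_mat (2 ^ n) (2 ^ n)" if "X \<in> pauli_set n" for X
      using that by (elim pauli_setE) simp
    thus ?thesis using that by (intro mat_assoc[of _ "2 ^ n"]) auto
  qed
  show "1\<^sub>m (2 ^ n) * A = A" if "A \<in> pauli_set n" for A
    using that by (elim pauli_setE) (simp add: left_mult_one_mat[of _ _ "2 ^ n"])
  show "\<exists>B\<in>pauli_set n. B * A = 1\<^sub>m (2 ^ n)" if "A \<in> pauli_set n" for A
    using that phase_pauli_inverse phases_cnj pauli_setI by (metis pauli_setE)
qed

section \<open>Maximal abelian subgroups from Lagrangian subspaces of labels\<close>

definition pauli_span :: "(bool \<times> bool) list \<Rightarrow> (bool \<times> bool) list \<Rightarrow> complex mat set" where
  "pauli_span v w = {c \<cdot>\<^sub>m pauli_op u | c u.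
     c \<in> phases \<and> u \<in> {zlab (length v), v, w, lxor v w}}"

text \<open>The span of \<open>v\<close> and \<open>w\<close> is isotropic and contains its own
  symplectic complement. The case \<open>v = w\<close> is allowed, which is how one qubit is
  covered.\<close>

definition lagrangian :: "nat \<Rightarrow> (bool \<times> bool) list \<Rightarrow> (bool \<times> bool) list \<Rightarrow> bool" where
  "lagrangian n v w \<longleftrightarrow> length v = n \<and> length w = n \<and> comm_sign v w = 1 \<and>
     (\<forall>u. length u = n \<longrightarrow> comm_sign u v = 1 \<longrightarrow> comm_sign u w = 1 \<longrightarrow> u \<in> {zlab n, v, w, lxor v w})"

text \<open>The four labels are closed under addition and have pairwise commutation sign 1, which
  gives an abelian subgroup. An element of a larger abelian subgroup commutes with both generators,
  so its label already lies in the span; all phases are present, so the element does too.\<close>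

lemma maximal_abelian_pauli_span:
  assumes "lagrangian n v w"
  shows "maximal_abelian_subgroup (pauli_span v w) (pauli_group n)"
proof -
  interpret group "pauli_group n" by (rule group_pauli_group)
  from assms have len: "length v = n" "length w = n" and vw: "comm_sign v w = 1"
    and max: "\<And>u. length u = n \<Longrightarrow> comm_sign u v = 1 \<Longrightarrow> comm_sign u w = 1 \<Longrightarrow> u \<in> {zlab n, v, w, lxor v w}"
    by (auto simp: lagrangian_def)
  let ?L = "{zlab n, v, w, lxor v w}"
  have L: "length u = n" if "u \<in> ?L" for u using that len by auto
  have span: "A \<in> pauli_span v w \<longleftrightarrow> (\<exists>c\<in>phases. \<exists>u\<in>?L. A = c \<cdot>\<^sub>m pauli_op u)" for A
    unfolding pauli_span_def len(1) by blast
  have closed: "lxor u u' \<in> ?L" if "u \<in> ?L" "u' \<in> ?L" for u u'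
    using that len lxor_cancel[of v w] lxor_cancel'[of v w] lxor_commute[of v w]
      lxor_commute[of v "lxor v w"] lxor_commute[of w "lxor v w"]
    by auto
  have comm: "comm_sign u u' = 1" if "u \<in> ?L" "u' \<in> ?L" for u u'
    using that len vw comm_sign_lxor[of v w] comm_sign_sym[of _ "lxor v w"] comm_sign_sym[of w v] by auto
  have 1: "subgroup (pauli_span v w) (pauli_group n)"
  proof (rule subgroupI)
    show "pauli_span v w \<subseteq> carrier (pauli_group n)"
      using L by (auto simp: span intro!: pauli_setI)
    show "pauli_span v w \<noteq> {}" using phases_1(1) span by blast
    fix A assume "A \<in> pauli_span v w"
    then obtain c u where A: "c \<in> phases" "u \<in> ?L" "A = c \<cdot>\<^sub>m pauli_op u" unfolding span by blast
    have "inv\<^bsub>pauli_group n\<^esub> A = cnj c \<cdot>\<^sub>m pauli_op u"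
      using A phase_pauli_inverse[OF A(1) L[OF A(2)]] phases_cnj L
      by (intro inv_equality) (auto intro!: pauli_setI)
    thus "inv\<^bsub>pauli_group n\<^esub> A \<in> pauli_span v w" using A phases_cnj unfolding span by blast
    fix B assume "B \<in> pauli_span v w"
    then obtain d u' where B: "d \<in> phases" "u' \<in> ?L" "B = d \<cdot>\<^sub>m pauli_op u'" unfolding span by blast
    have "A * B \<in> pauli_span v w"
      using phase_pauli_mult[OF A(1) B(1) L[OF A(2)] L[OF B(2)]] closed[OF A(2) B(2)] 
      unfolding span A B by blast
    thus "A \<otimes>\<^bsub>pauli_group n\<^esub> B \<in> pauli_span v w" by simp
  qed
  have 2: "comm_group ((pauli_group n)\<lparr>carrier := pauli_span v w\<rparr>)"
  proof (rule group.group_comm_groupI)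
    show "group ((pauli_group n)\<lparr>carrier := pauli_span v w\<rparr>)"
      using 1 by (rule subgroup.subgroup_is_group) (rule group_pauli_group)
    fix A B assume "A \<in> carrier ((pauli_group n)\<lparr>carrier := pauli_span v w\<rparr>)"
      "B \<in> carrier ((pauli_group n)\<lparr>carrier := pauli_span v w\<rparr>)"
    then obtain c u d u' where A: "u \<in> ?L" "A = c \<cdot>\<^sub>m pauli_op u" and B: "u' \<in> ?L" "B = d \<cdot>\<^sub>m pauli_op u'"
      using span by auto
    have "pauli_op u * pauli_op u' = pauli_op u' * pauli_op u"
      using comm_sign_eq_1_iff[OF L[OF A(1)] L[OF B(1)]] comm[OF A(1) B(1)] by simp
    hence "A * B = B * A"
      unfolding A B using L[OF A(1)] L[OF B(1)] by (simp add: smult_mult[of _ "2 ^ n"] smult_smult mult.commute)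
    thus "A \<otimes>\<^bsub>(pauli_group n)\<lparr>carrier := pauli_span v w\<rparr>\<^esub> B = B \<otimes>\<^bsub>(pauli_group n)\<lparr>carrier := pauli_span v w\<rparr>\<^esub> A"
      by simp
  qed
  have "H = pauli_span v w" if H: "abelian_subgroup H (pauli_group n)" "pauli_span v w \<subseteq> H" for H
  proof (intro antisym H(2) subsetI)
    fix A assume A: "A \<in> H"
    have "A \<in> pauli_set n"
      using A H(1) subgroup.subset by (fastforce simp: abelian_subgroup_def)
    then obtain c u where cu: "c \<in> phases" "length u = n" "A = c \<cdot>\<^sub>m pauli_op u" by (rule pauli_setE)
    have comm: "A * B = B * A" if "B \<in> H" for B
      using comm_groupE(4)[of "(pauli_group n)\<lparr>carrier := H\<rparr>" A B] A that H(1)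
      by (simp add: abelian_subgroup_def)
    have "comm_sign u t = 1" if t: "t \<in> ?L" for t
    proof -
      have "1 \<cdot>\<^sub>m pauli_op t \<in> H" using H(2) span t phases_1(1) by blast
      hence "c \<cdot>\<^sub>m pauli_op u * (1 \<cdot>\<^sub>m pauli_op t) = 1 \<cdot>\<^sub>m pauli_op t * (c \<cdot>\<^sub>m pauli_op u)"
        using comm cu(3) by blast
      hence "(cnj c * c) \<cdot>\<^sub>m (pauli_op u * pauli_op t) = (cnj c * c) \<cdot>\<^sub>m (pauli_op t * pauli_op u)"
        using cu(2) L[OF t] by (simp add: smult_mult[of _ "2 ^ n"] one_smult flip: smult_smult)
      thus ?thesis using comm_sign_eq_1_iff[OF cu(2) L[OF t]] phases_cnj_mult[OF cu(1)]
        by (simp add: one_smult)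
    qed
    hence "u \<in> ?L" using max cu(2) by blast
    thus "A \<in> pauli_span v w" using cu span by blast
  qed
  thus ?thesis using 1 2 by (simp add: maximal_abelian_subgroup_def abelian_subgroup_def)
qed

text \<open>Two generators suffice: the image of the product label follows by multiplicativity up to
  a phase, and since the spans contain all phases, one span is carried onto the other.\<close>

lemma semi_clifford_lagrangian:
  assumes U: "unitary_gate n U" and vw: "lagrangian n v w" and vw': "lagrangian n v' w'"
    and c: "c \<in> phases" "conj_by U (pauli_op v) = c \<cdot>\<^sub>m pauli_op v'"
    and d: "d \<in> phases" "conj_by U (pauli_op w) = d \<cdot>\<^sub>m pauli_op w'"
  shows "semi_clifford n U"
proof -
  from vw vw' have len: "length v = n" "length w = n" "length v' = n" "length w' = n"
    by (auto simp: lagrangian_def)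
  \<comment> \<open>Pairs each label of the source span with the label of its image, so that both
    inclusions can be read off one relation.\<close>
  define R where "R = {(zlab n, zlab n), (v, v'), (w, w'), (lxor v w, lxor v' w')}"
  have R: "\<exists>e\<in>phases. conj_by U (pauli_op u) = e \<cdot>\<^sub>m pauli_op u'" if "(u, u') \<in> R" for u u'
  proof -
    have "\<exists>e\<in>phases. conj_by U (pauli_op (zlab n)) = e \<cdot>\<^sub>m pauli_op (zlab n)"
      using U by (intro bexI[of _ 1]) (auto simp: pauli_op_zero conj_by_one one_smult)
    moreover have "\<exists>e\<in>phases. conj_by U (pauli_op (lxor v w)) = e \<cdot>\<^sub>m pauli_op (lxor v' w')"
    proof -
      obtain a where a: "a \<in> phases" "pauli_op v * pauli_op w = a \<cdot>\<^sub>m pauli_op (lxor v w)"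
        using pauli_op_mult[of v w] len by auto
      obtain b where b: "b \<in> phases" "(c \<cdot>\<^sub>m pauli_op v') * (d \<cdot>\<^sub>m pauli_op w') = b \<cdot>\<^sub>m pauli_op (lxor v' w')"
        using phase_pauli_mult[OF c(1) d(1) len(3,4)] by auto
      have "conj_by U (pauli_op (lxor v w)) = cnj a \<cdot>\<^sub>m conj_by U (a \<cdot>\<^sub>m pauli_op (lxor v w))"
        using U len by (simp add: conj_by_smult smult_smult phases_cnj_mult[OF a(1)] one_smult)
      also have "\<dots> = (cnj a * b) \<cdot>\<^sub>m pauli_op (lxor v' w')"
        using U len by (simp add: a(2)[symmetric] conj_by_mult c d b smult_smult)
      finally show ?thesis using phases_mult[OF phases_cnj[OF a(1)] b(1)] by blast
    qed
    ultimately show ?thesis using that c d unfolding R_def by blast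
  qed
  have Rlen: "length u = n" "length u' = n" if "(u, u') \<in> R" for u u'
    using that len by (auto simp: R_def)
  have s: "A \<in> pauli_span v w \<longleftrightarrow> (\<exists>a\<in>phases. \<exists>u u'. (u, u') \<in> R \<and> A = a \<cdot>\<^sub>m pauli_op u)"
    and s': "A \<in> pauli_span v' w' \<longleftrightarrow> (\<exists>a\<in>phases. \<exists>u u'. (u, u') \<in> R \<and> A = a \<cdot>\<^sub>m pauli_op u')" for A
    unfolding pauli_span_def len R_def by blast+
  have "conj_by U ` pauli_span v w = pauli_span v' w'"
  proof (intro equalityI subsetI)
    fix B assume "B \<in> conj_by U ` pauli_span v w"
    then obtain a u u' where a: "a \<in> phases" "(u, u') \<in> R" "B = conj_by U (a \<cdot>\<^sub>m pauli_op u)"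
      using s by (force simp: image_iff)
    with R obtain e where e: "e \<in> phases" "conj_by U (pauli_op u) = e \<cdot>\<^sub>m pauli_op u'" by blast
    have "B = (a * e) \<cdot>\<^sub>m pauli_op u'"
      using U a Rlen e by (simp add: conj_by_smult smult_smult)
    thus "B \<in> pauli_span v' w'" using s' a e phases_mult by blast
  next
    fix B assume "B \<in> pauli_span v' w'"
    then obtain a u u' where a: "a \<in> phases" "(u, u') \<in> R" "B = a \<cdot>\<^sub>m pauli_op u'"
      using s' by blast
    with R obtain e where e: "e \<in> phases" "conj_by U (pauli_op u) = e \<cdot>\<^sub>m pauli_op u'" by blast
    have "B = conj_by U ((a * cnj e) \<cdot>\<^sub>m pauli_op u)"
      using U a Rlen e by (simp add: conj_by_smult smult_smult mult.assoc phases_cnj_mult)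
    thus "B \<in> conj_by U ` pauli_span v w" using s a e phases_mult phases_cnj by blast
  qed
  thus ?thesis using maximal_abelian_pauli_span[OF vw] maximal_abelian_pauli_span[OF vw'] U
    unfolding semi_clifford_def by metis
qed

subsection \<open>Block monomial unitary matrices\<close>

text \<open>A form of block monomiality: \<open>g\<close> colours the columns, and the nonzero
  entries of a row share one colour. Four colours are enough, since \<open>g\<close> will record the
  signs of two Pauli operators.\<close>

definition class_supported :: "(nat \<Rightarrow> nat \<Rightarrow> complex) \<Rightarrow> bool" where
  "class_supported M \<longleftrightarrow> (\<exists>g :: nat \<Rightarrow> bool \<times> bool.
     (\<forall>l. card {y. y < 6 \<and> g y = l} \<le> 2) \<and>
     (\<forall>x<6. \<forall>y<6. \<forall>z<6. M x y \<noteq> 0 \<longrightarrow> M x z \<noteq> 0 \<longrightarrow> g y = g z))"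

text \<open>Diagonal entries other than 0, 1 and -1 come in pairs \<open>t\<close>,
  \<open>-t\<close>, by orthogonality of the two rows that meet in a block of size two. They drop
  out of the trace, so the entries 1 and -1 alone add up to 2.\<close>

lemma class_supported_diag:
  assumes "class_supported M"
    and herm: "\<And>x y. x < 6 \<Longrightarrow> y < 6 \<Longrightarrow> M y x = cnj (M x y)"
    and unit: "\<And>x y. x < 6 \<Longrightarrow> y < 6 \<Longrightarrow> (\<Sum>z<6. M x z * cnj (M y z)) = (if x = y then 1 else 0)"
    and trace: "(\<Sum>x<6. M x x) = 2"
  shows "card {x. x < 6 \<and> M x x = 1} = 2 + card {x. x < 6 \<and> M x x = -1}"
proof -
  obtain g :: "nat \<Rightarrow> bool \<times> bool" where
    fib: "\<And>l. card {y. y < 6 \<and> g y = l} \<le> 2" and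
    g: "\<And>x y z. x < 6 \<Longrightarrow> y < 6 \<Longrightarrow> z < 6 \<Longrightarrow> M x y \<noteq> 0 \<Longrightarrow> M x z \<noteq> 0 \<Longrightarrow> g y = g z"
    using assms(1) unfolding class_supported_def by blast
  define A where "A = {x. x < 6 \<and> M x x \<noteq> 0 \<and> M x x \<noteq> 1 \<and> M x x \<noteq> -1}"
  \<comment> \<open>A colour is carried by at most two columns, so two nonzero entries of a row
    exhaust its support.\<close>
  have third: "M x z = 0" if "x < 6" "y < 6" "z < 6" "y \<noteq> z" "u \<noteq> y" "u \<noteq> z" "u < 6" "M x y \<noteq> 0" "M x u \<noteq> 0" for x y z u
  proof (rule ccontr)
    assume "M x z \<noteq> 0"
    hence "{y, z, u} \<subseteq> {y'. y' < 6 \<and> g y' = g y}" using that g by blast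
    hence "card {y, z, u} \<le> card {y'. y' < 6 \<and> g y' = g y}" by (intro card_mono) auto
    with fib[of "g y"] that show False by auto
  qed
  \<comment> \<open>If the diagonal entry were the only nonzero one in its row, unit length and
    reality would make its square 1, which \<open>A\<close> excludes.\<close>
  have ex: "\<exists>y. y < 6 \<and> y \<noteq> x \<and> M x y \<noteq> 0" if "x \<in> A" for x
  proof (rule ccontr)
    assume "\<not> ?thesis"
    hence z: "M x z = 0" if "z < 6" "z \<noteq> x" for z using that by auto
    have x: "x < 6" using that by (simp add: A_def)
    have "1 = (\<Sum>z<6. M x z * cnj (M x z))" using unit[OF x x] by simp
    also have "\<dots> = (\<Sum>z<6. if z = x then M x x * cnj (M x x) else 0)"
      using z by (intro sum.cong) auto
    also have "\<dots> = M x x * M x x" using x herm[OF x x] by simp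
    finally have "M x x = 1 \<or> M x x = -1"
      using square_eq_1_iff[of "M x x"] by simp
    thus False using that by (simp add: A_def)
  qed
  \<comment> \<open>The partner column of \<open>x\<close>. It will turn out to be an involution of
    \<open>A\<close> that negates the diagonal entry.\<close>
  define s where "s x = (SOME y. y < 6 \<and> y \<noteq> x \<and> M x y \<noteq> 0)" for x
  have s: "s x < 6" "s x \<noteq> x" "M x (s x) \<noteq> 0" if "x \<in> A" for x
    using someI_ex[OF ex[OF that]] unfolding s_def by auto
  have s': "M (s x) (s x) = - M x x \<and> s x \<in> A \<and> s (s x) = x" if xA: "x \<in> A" for x
  proof -
    let ?y = "s x"
    note y = s[OF xA]
    have x: "x < 6" "M x x \<noteq> 0" using xA by (auto simp: A_def)
    have yx: "M ?y x \<noteq> 0" using herm[OF x(1) y(1)] y(3) by simp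
    \<comment> \<open>Rows \<open>x\<close> and \<open>?y\<close> are orthogonal, and by
      \<open>third\<close> only the columns \<open>x\<close> and \<open>?y\<close> contribute to
      their inner product.\<close>
    have "0 = (\<Sum>z<6. M x z * cnj (M ?y z))" using unit[OF x(1) y(1)] y(2) by simp
    also have "\<dots> = (\<Sum>z\<in>{x, ?y}. M x z * cnj (M ?y z))"
      using third[of x ?y _ x] x y by (intro sum.mono_neutral_right) auto
    also have "\<dots> = M x x * M x ?y + M x ?y * M ?y ?y"
      using y herm[OF y(1) x(1)] herm[OF y(1) y(1)] by simp
    also have "\<dots> = M x ?y * (M ?y ?y + M x x)" by (simp add: algebra_simps)
    finally have neg: "M ?y ?y = - M x x" using y(3) by (simp add: eq_neg_iff_add_eq_0)
    hence yA: "?y \<in> A" using xA y(1) by (auto simp: A_def minus_equation_iff[of "M x x"])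
    have "s ?y = x"
    proof (rule ccontr)
      assume ne: "s ?y \<noteq> x"
      have "M ?y (s ?y) = 0"
        using third[OF y(1) y(1), of "s ?y" x] s[OF yA] yx x y neg ne by auto
      thus False using s[OF yA] by simp
    qed
    thus ?thesis using neg yA by blast
  qed
  \<comment> \<open>Reindexing along the involution shows that the sum equals its own
    negative.\<close>
  have "(\<Sum>x\<in>A. M x x) = (\<Sum>x\<in>A. M (s x) (s x))"
    by (rule sum.reindex_bij_witness[of _ s s]) (use s' in auto)
  also have "\<dots> = - (\<Sum>x\<in>A. M x x)" using s' by (simp add: sum_negf)
  finally have A0: "(\<Sum>x\<in>A. M x x) = 0" by simp
  let ?P = "{x. x < 6 \<and> M x x = 1}" and ?N = "{x. x < 6 \<and> M x x = -1}"
  have "2 = (\<Sum>x\<in>A \<union> (?P \<union> ?N). M x x)"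
    unfolding trace[symmetric] by (rule sum.mono_neutral_right) (auto simp: A_def)
  also have "\<dots> = (\<Sum>x\<in>A. M x x) + ((\<Sum>x\<in>?P. M x x) + (\<Sum>x\<in>?N. M x x))"
    by (subst sum.union_disjoint, auto simp: A_def)
       (subst sum.union_disjoint, auto)
  also have "\<dots> = of_nat (card ?P) - of_nat (card ?N)" using A0 by simp
  finally have "of_nat (2 + card ?N) = (of_nat (card ?P) :: complex)" by (simp add: algebra_simps)
  thus ?thesis by (simp only: of_nat_eq_iff)
qed

text \<open>The matrix is \<open>1 - 2 P\<close> with \<open>P\<close> the projector onto the span
  of \<open>a\<close> and \<open>b\<close>: Hermitian, unitary and of trace
  \<open>6 - 4 = 2\<close>, so \<open>class_supported_diag\<close> applies. Its diagonal entry is 1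
  where both vectors vanish and -1 where their weights add up to 1.\<close>

lemma projector_class_supported:
  fixes a b :: "nat \<Rightarrow> complex"
  assumes a: "(\<Sum>z<6. a z * cnj (a z)) = 1" and b: "(\<Sum>z<6. b z * cnj (b z)) = 1"
    and ab: "(\<Sum>z<6. a z * cnj (b z)) = 0"
    and cs: "class_supported (\<lambda>x y. (if x = y then 1 else 0) - 2 * (a x * cnj (a y) + b x * cnj (b y)))"
  shows "card {x. x < 6 \<and> a x = 0 \<and> b x = 0} = 2 + card {x. x < 6 \<and> (cmod (a x))\<^sup>2 + (cmod (b x))\<^sup>2 = 1}"
proof -
  define P where "P x y = a x * cnj (a y) + b x * cnj (b y)" for x y
  define M where "M x y = (if x = y then 1 else 0) - 2 * P x y" for x y
  have ba: "(\<Sum>z<6. b z * cnj (a z)) = 0"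
    using arg_cong[OF ab, of cnj] by (simp add: mult.commute)
  have proj: "(\<Sum>z<6. P x z * cnj (P y z)) = P x y" for x y
  proof -
    have "(\<Sum>z<6. P x z * cnj (P y z)) =
        a x * cnj (a y) * (\<Sum>z<6. a z * cnj (a z)) + b x * cnj (b y) * (\<Sum>z<6. b z * cnj (b z)) +
        (a x * cnj (b y) * (\<Sum>z<6. b z * cnj (a z)) + b x * cnj (a y) * (\<Sum>z<6. a z * cnj (b z)))"
      unfolding P_def sum_distrib_left sum.distrib[symmetric] by (intro sum.cong) (auto simp: algebra_simps)
    thus ?thesis unfolding a b ab ba by (simp add: P_def)
  qed
  have herm: "P y x = cnj (P x y)" for x y by (simp add: P_def mult.commute)
  have unit: "(\<Sum>z<6. M x z * cnj (M y z)) = (if x = y then 1 else 0)" if "x < 6" "y < 6" for x y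
  proof -
    have "(\<Sum>z<6. M x z * cnj (M y z)) =
       (\<Sum>z<6. (if z = x then (if x = y then 1 else 0) else 0) - (if z = x then 2 * cnj (P y z) else 0)
            - (if z = y then 2 * P x z else 0) + 4 * (P x z * cnj (P y z)))"
      by (intro sum.cong) (auto simp: M_def algebra_simps)
    also have "\<dots> = (if x = y then 1 else 0) - 2 * cnj (P y x) - 2 * P x y + 4 * (\<Sum>z<6. P x z * cnj (P y z))"
      using that by (simp add: sum.distrib sum_subtractf sum_distrib_left)
    also have "\<dots> = (if x = y then 1 else 0)" using proj herm[of x y] by simp
    finally show ?thesis .
  qed
  have lin: "1 - 2 * t = 1 \<longleftrightarrow> t = 0" "1 - 2 * t = -1 \<longleftrightarrow> t = 1" for t :: real
    by auto
  have diag: "M x x = complex_of_real (1 - 2 * ((cmod (a x))\<^sup>2 + (cmod (b x))\<^sup>2))" for x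
    unfolding M_def P_def by (simp only: complex_norm_square[symmetric] if_True simp_thms) simp
  have trace: "(\<Sum>x<6. M x x) = 2"
  proof -
    have "(\<Sum>x<6. M x x) = 6 - 2 * ((\<Sum>z<6. a z * cnj (a z)) + (\<Sum>z<6. b z * cnj (b z)))"
      by (simp add: M_def P_def sum_subtractf sum.distrib sum_distrib_left)
    thus ?thesis using a b by simp
  qed
  have "class_supported M" using cs by (simp add: M_def[abs_def] P_def)
  hence "card {x. x < 6 \<and> M x x = 1} = 2 + card {x. x < 6 \<and> M x x = -1}"
  proof (rule class_supported_diag)
    show "M y x = cnj (M x y)" for x y by (simp add: M_def herm[of x y])
  qed (rule unit trace; assumption)+
  moreover have "M x x = 1 \<longleftrightarrow> a x = 0 \<and> b x = 0" for x
  proof -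
    have "M x x = 1 \<longleftrightarrow> (cmod (a x))\<^sup>2 + (cmod (b x))\<^sup>2 = 0"
      unfolding diag by (simp only: of_real_eq_1_iff lin)
    thus ?thesis by simp
  qed
  moreover have "M x x = -1 \<longleftrightarrow> (cmod (a x))\<^sup>2 + (cmod (b x))\<^sup>2 = 1" for x
  proof -
    have "M x x = -1 \<longleftrightarrow> complex_of_real (1 - 2 * ((cmod (a x))\<^sup>2 + (cmod (b x))\<^sup>2)) = complex_of_real (-1)"
      unfolding diag by simp
    also have "\<dots> \<longleftrightarrow> (cmod (a x))\<^sup>2 + (cmod (b x))\<^sup>2 = 1"
      unfolding of_real_eq_iff by (rule lin)
    finally show ?thesis .
  qed
  ultimately show ?thesis by simp
qed

section \<open>Column supports of a six by six unitary matrix\<close>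

lemma card_filter: "finite A \<Longrightarrow> card {y \<in> A. P y} = (\<Sum>y\<in>A. if P y then 1 else 0)"
  unfolding card_eq_sum by (rule sum.inter_filter)

text \<open>\<open>Q\<close> carries the coordinate plane \<open>A\<close> into \<open>A'\<close>
  and the complementary coordinates into the complement of \<open>A'\<close>.\<close>

definition matched :: "(nat \<Rightarrow> nat \<Rightarrow> complex) \<Rightarrow> nat set \<Rightarrow> nat set \<Rightarrow> bool" where
  "matched Q A A' \<longleftrightarrow> A \<subseteq> {..<6} \<and> A' \<subseteq> {..<6} \<and> card A = 2 \<and> card A' = 2 \<and>
     (\<forall>x<6. \<forall>y<6. Q x y \<noteq> 0 \<longrightarrow> (x \<in> A' \<longleftrightarrow> y \<in> A))"

text \<open>The matrix in \<open>refl_supported\<close> is the reflection that negates the span of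
  columns \<open>i\<close> and \<open>j\<close>. For the action of a gate it arises, up to sign,
  from a conjugated Pauli operator.\<close>

locale class_supported_unitary =
  fixes Q :: "nat \<Rightarrow> nat \<Rightarrow> complex"
  assumes rows: "\<And>x y. x < 6 \<Longrightarrow> y < 6 \<Longrightarrow> (\<Sum>z<6. Q x z * cnj (Q y z)) = (if x = y then 1 else 0)"
    and cols: "\<And>x y. x < 6 \<Longrightarrow> y < 6 \<Longrightarrow> (\<Sum>z<6. Q z x * cnj (Q z y)) = (if x = y then 1 else 0)"
    and refl_supported: "\<And>i j. i < 6 \<Longrightarrow> j < 6 \<Longrightarrow> i \<noteq> j \<Longrightarrow>
      class_supported (\<lambda>x y. (if x = y then 1 else 0) - 2 * (Q x i * cnj (Q y i) + Q x j * cnj (Q y j)))"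
begin

definition supp :: "nat \<Rightarrow> nat set" where
  "supp y = {x. x < 6 \<and> Q x y \<noteq> 0}"

lemma supp_simps [simp]: "finite (supp y)" "supp y \<subseteq> {..<6}" "x \<in> supp y \<longleftrightarrow> x < 6 \<and> Q x y \<noteq> 0"
  by (auto simp: supp_def)

lemma card_common_zeros:
  assumes "i < 6" "j < 6" "i \<noteq> j"
  shows "card ({..<6} - supp i - supp j) = 2 + card {x. x < 6 \<and> (cmod (Q x i))\<^sup>2 + (cmod (Q x j))\<^sup>2 = 1}"
proof -
  have "{..<6} - supp i - supp j = {x. x < 6 \<and> Q x i = 0 \<and> Q x j = 0}" by auto
  thus ?thesis
    using projector_class_supported[of "\<lambda>x. Q x i" "\<lambda>x. Q x j"] cols refl_supported assms by simp
qed

text \<open>Otherwise the zero set \<open>R\<close> of column \<open>a\<close> has at most three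
  rows. Every other column shares two zeros with \<open>a\<close>, so it meets \<open>R\<close> in
  at most \<open>card R - 2\<close> rows. Counting the nonzero entries in \<open>R\<close> yields a
  row with just one, necessarily of modulus 1, and this raises the number of common zeros beyond
  what \<open>R\<close> can hold.\<close>

lemma card_supp_le:
  assumes a: "a < 6"
  shows "card (supp a) \<le> 2"
proof (rule ccontr)
  assume big: "\<not> ?thesis"
  define R where "R = {..<6} - supp a"
  define N where "N x = {y. y < 6 \<and> Q x y \<noteq> 0}" for x
  have finR [simp]: "finite R" by (simp add: R_def)
  have cR: "card R \<le> 3" using big by (simp add: R_def card_Diff_subset)
  have split: "card (R - supp b) + card (R \<inter> supp b) = card R" for b
    using card_Int_Diff[OF finR, of "supp b"] by simp
  have zero: "card (R - supp b) \<ge> 2" if "b < 6" "b \<noteq> a" for b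
    using card_common_zeros[of a b] that a by (simp add: R_def)
  have R2: "card R \<ge> 2"
  proof -
    obtain b :: nat where "b < 6" "b \<noteq> a" by (metis one_less_numeral_iff semiring_norm(76) zero_less_numeral zero_neq_one)
    thus ?thesis using zero[of b] split[of b] by simp
  qed
  have Ncard: "card (N x) \<ge> 1" if "x \<in> R" for x
  proof -
    have x: "x < 6" using that by (simp add: R_def)
    have "N x \<noteq> {}"
    proof
      assume "N x = {}"
      hence "(\<Sum>z<6. Q x z * cnj (Q x z)) = 0" by (auto simp: N_def)
      thus False using rows[OF x x] by simp
    qed
    moreover have "finite (N x)" by (simp add: N_def)
    ultimately show ?thesis by (simp add: Suc_le_eq card_gt_0_iff)
  qed
  have "(\<Sum>x\<in>R. card (N x)) = (\<Sum>x\<in>R. \<Sum>y<6. if Q x y \<noteq> 0 then 1 else 0)"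
    unfolding N_def by (intro sum.cong refl) (simp only: card_filter[OF finite_lessThan, symmetric] lessThan_iff)
  also have "\<dots> = (\<Sum>y<6. \<Sum>x\<in>R. if Q x y \<noteq> 0 then 1 else 0)" by (rule sum.swap)
  also have "\<dots> = (\<Sum>y<6. card (R \<inter> supp y))"
  proof (rule sum.cong[OF refl])
    fix y
    have "R \<inter> supp y = {x \<in> R. Q x y \<noteq> 0}" by (auto simp: R_def)
    thus "(\<Sum>x\<in>R. if Q x y \<noteq> 0 then 1 else 0) = card (R \<inter> supp y)"
      by (simp only: card_filter[OF finR])
  qed
  \<comment> \<open>Column \<open>a\<close> vanishes on \<open>R\<close>, so only five columns
    remain.\<close>
  also have "\<dots> = (\<Sum>y\<in>{..<6} - {a}. card (R \<inter> supp y))"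
    by (rule sum.mono_neutral_right) (auto simp: R_def)
  also have "\<dots> \<le> (\<Sum>y\<in>{..<6} - {a}. card R - 2)"
  proof (rule sum_mono)
    fix y assume "y \<in> {..<6} - {a}"
    thus "card (R \<inter> supp y) \<le> card R - 2" using zero[of y] split[of y] by simp
  qed
  also have "\<dots> = 5 * (card R - 2)" using a by simp
  finally have le: "(\<Sum>x\<in>R. card (N x)) \<le> 5 * (card R - 2)" .
  \<comment> \<open>With two entries in every row, \<open>2 * card R\<close> would be at most
    \<open>5 * (card R - 2)\<close>, forcing \<open>card R\<close> to be at least 4.\<close>
  have "\<exists>x\<in>R. card (N x) = 1"
  proof (rule ccontr)
    assume "\<not> ?thesis"
    hence "(\<Sum>x\<in>R. card (N x)) \<ge> (\<Sum>x\<in>R. 2)" using Ncard by (intro sum_mono) force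
    thus False using le cR R2 by simp
  qed
  then obtain x where x: "x \<in> R" "card (N x) = 1" by blast
  then obtain b where b: "N x = {b}" by (auto simp: card_1_singleton_iff)
  have xb: "x < 6" "b < 6" "Q x b \<noteq> 0" "b \<noteq> a" "Q x a = 0" using x b by (auto simp: R_def N_def)
  have "1 = (\<Sum>z<6. Q x z * cnj (Q x z))" using rows[OF xb(1) xb(1)] by simp
  also have "\<dots> = (\<Sum>z\<in>{b}. Q x z * cnj (Q x z))"
    using b xb by (intro sum.mono_neutral_right) (auto simp: N_def)
  also have "\<dots> = complex_of_real ((cmod (Q x b))\<^sup>2)" unfolding complex_norm_square by simp
  finally have "complex_of_real ((cmod (Q x b))\<^sup>2) = 1" by (rule sym)
  hence "(cmod (Q x b))\<^sup>2 = 1" by (simp only: of_real_eq_1_iff)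
  \<comment> \<open>The entry of modulus 1 makes \<open>x\<close> a row counted on the right of
    \<open>card_common_zeros\<close>, so \<open>a\<close> and \<open>b\<close> have three common
    zeros. As \<open>x\<close> lies in \<open>R\<close> but is not one of them, \<open>R\<close>
    would need a fourth row.\<close>
  hence "x \<in> {x. x < 6 \<and> (cmod (Q x a))\<^sup>2 + (cmod (Q x b))\<^sup>2 = 1}" using xb by simp
  hence "card {x} \<le> card {x. x < 6 \<and> (cmod (Q x a))\<^sup>2 + (cmod (Q x b))\<^sup>2 = 1}"
    by (intro card_mono) auto
  hence "card (R - supp b) \<ge> 3" using card_common_zeros[OF a xb(2)] xb by (simp add: R_def)
  moreover have "card (R - supp b) < card R"
    using x(1) xb by (intro psubset_card_mono) auto
  ultimately show False using cR by simp
qed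

text \<open>An overlap in a single row would leave one nonzero term in the inner product of two
  orthogonal columns. Hence overlapping supports share two rows, and neither has room for
  more.\<close>

lemma supp_eq_or_disjoint:
  assumes y: "y < 6" "z < 6" "x \<in> supp y" "x \<in> supp z"
  shows "supp y = supp z"
proof (cases "y = z")
  case False
  have "card (supp y \<inter> supp z) \<noteq> 1"
  proof
    assume "card (supp y \<inter> supp z) = 1"
    then obtain t where "supp y \<inter> supp z = {t}" by (rule card_1_singletonE)
    moreover from this have "x \<in> {t}" using y by blast
    ultimately have *: "supp y \<inter> supp z = {x}" by blast
    have "(\<Sum>t<6. Q t y * cnj (Q t z)) = (\<Sum>t\<in>{x}. Q t y * cnj (Q t z))"
    proof (rule sum.mono_neutral_right)
      show "\<forall>t\<in>{..<6} - {x}. Q t y * cnj (Q t z) = 0"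
      proof
        fix t assume t: "t \<in> {..<6} - {x}"
        hence "t \<notin> supp y \<inter> supp z" using * by simp
        thus "Q t y * cnj (Q t z) = 0" using t by auto
      qed
    qed (use y in auto)
    thus False using cols[OF y(1,2)] False y by simp
  qed
  moreover have "card (supp y \<inter> supp z) \<noteq> 0" using y by auto
  ultimately have "card (supp y \<inter> supp z) \<ge> 2" by linarith
  hence "supp y \<inter> supp z = supp y" "supp y \<inter> supp z = supp z"
    using card_supp_le[OF y(1)] card_supp_le[OF y(2)] by (intro card_seteq; simp only: supp_simps Int_lower1 Int_lower2)+
  thus ?thesis by blast
qed auto

text \<open>The rows in \<open>supp y\<close> are nonzero only in the columns of this class, so the
  block has unit rows and unit columns. Summing squared moduli in both orders shows that it is
  square.\<close>

lemma card_supp_class: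
  assumes y: "y < 6"
  shows "card {z. z < 6 \<and> supp z = supp y} = card (supp y)"
proof -
  let ?C = "{z. z < 6 \<and> supp z = supp y}"
  have C: "Q x z = 0" if "x \<in> supp y" "z < 6" "z \<notin> ?C" for x z
  proof (rule ccontr)
    assume "Q x z \<noteq> 0"
    hence "x \<in> supp z" using that(1) by simp
    thus False using supp_eq_or_disjoint[OF that(2) y] that by blast
  qed
  have "complex_of_nat (card ?C) = (\<Sum>z\<in>?C. 1)" by simp
  also have "\<dots> = (\<Sum>z\<in>?C. \<Sum>x\<in>supp y. Q x z * cnj (Q x z))"
  proof (rule sum.cong[OF refl])
    fix z assume "z \<in> ?C"
    hence z: "z < 6" "supp z = supp y" by auto
    have "(\<Sum>x<6. Q x z * cnj (Q x z)) = (\<Sum>x\<in>supp y. Q x z * cnj (Q x z))"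
      unfolding z(2)[symmetric] by (rule sum.mono_neutral_right) auto
    thus "1 = (\<Sum>x\<in>supp y. Q x z * cnj (Q x z))" using cols[OF z(1) z(1)] by simp
  qed
  also have "\<dots> = (\<Sum>x\<in>supp y. \<Sum>z\<in>?C. Q x z * cnj (Q x z))" by (rule sum.swap)
  also have "\<dots> = (\<Sum>x\<in>supp y. 1)"
  proof (rule sum.cong[OF refl])
    fix x assume x: "x \<in> supp y"
    hence "x < 6" by simp
    have "(\<Sum>z<6. Q x z * cnj (Q x z)) = (\<Sum>z\<in>?C. Q x z * cnj (Q x z))"
      using C[OF x] by (intro sum.mono_neutral_right) auto
    thus "(\<Sum>z\<in>?C. Q x z * cnj (Q x z)) = 1" using rows[OF \<open>x < 6\<close> \<open>x < 6\<close>] by simp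
  qed
  also have "\<dots> = of_nat (card (supp y))" by simp
  finally show ?thesis by (simp only: of_nat_eq_iff)
qed

lemma supp_nonempty:
  assumes "y < 6"
  shows "card (supp y) \<noteq> 0"
proof -
  have "y \<in> {z. z < 6 \<and> supp z = supp y}" using assms by simp
  moreover have "finite {z. z < 6 \<and> supp z = supp y}" by simp
  ultimately have "card {z. z < 6 \<and> supp z = supp y} \<noteq> 0" using card_0_eq by blast
  thus ?thesis unfolding card_supp_class[OF assms] .
qed

lemma matched_class:
  assumes "y < 6" "card (supp y) = 2"
  shows "matched Q {z. z < 6 \<and> supp z = supp y} (supp y)"
  unfolding matched_def using assms card_supp_class[OF assms(1)] supp_eq_or_disjoint[OF _ assms(1)]
  by auto

text \<open>A class of columns with a one-element support has one member, so different such columns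
  have disjoint supports and two of them occupy two rows of their own.\<close>

lemma matched_singletons:
  assumes "A \<subseteq> {z. z < 6 \<and> card (supp z) = 1}" "card A = 2"
  shows "matched Q A (\<Union>z\<in>A. supp z)"
proof -
  have inj: "y = z" if "y \<in> A" "z < 6" "supp y = supp z" for y z
  proof -
    have "card {z. z < 6 \<and> supp z = supp y} = 1" using card_supp_class[of y] that(1) assms(1) by auto
    then obtain t where t: "{z. z < 6 \<and> supp z = supp y} = {t}" by (auto simp: card_1_singleton_iff)
    have "y \<in> {z. z < 6 \<and> supp z = supp y}" "z \<in> {z. z < 6 \<and> supp z = supp y}"
      using that assms(1) by auto
    thus ?thesis unfolding t by simp
  qed
  obtain y z where A: "A = {y, z}" "y \<noteq> z" using assms(2) by (auto simp: card_2_iff)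
  have yz: "y < 6" "z < 6" "card (supp y) = 1" "card (supp z) = 1" using A assms(1) by auto
  have "supp y \<inter> supp z = {}" using inj[of y z] supp_eq_or_disjoint[OF yz(1,2)] A yz by blast
  hence "card (\<Union>z\<in>A. supp z) = 2" using A yz by (simp add: card_Un_disjoint)
  moreover have "x \<in> (\<Union>z\<in>A. supp z) \<longleftrightarrow> t \<in> A" if "x < 6" "t < 6" "Q x t \<noteq> 0" for x t
  proof
    assume "x \<in> (\<Union>z\<in>A. supp z)"
    then obtain u where u: "u \<in> A" "x \<in> supp u" by blast
    have "u < 6" using u assms(1) by auto
    hence "supp u = supp t" using supp_eq_or_disjoint[of u t x] u that by simp
    thus "t \<in> A" using inj[OF u(1) that(2)] u by simp
  qed (use that in auto)
  ultimately show ?thesis unfolding matched_def using assms by auto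
qed

text \<open>Two different supports of size two give two blocks. Otherwise at most two columns have a
  support of size two, and the remaining four or more, with one entry each, contain two disjoint
  pairs.\<close>

theorem two_matched_pairs:
  "\<exists>A B A' B'. matched Q A A' \<and> matched Q B B' \<and> A \<inter> B = {}"
proof (cases "\<exists>y z. y < 6 \<and> z < 6 \<and> card (supp y) = 2 \<and> card (supp z) = 2 \<and> supp y \<noteq> supp z")
  case True
  then obtain y z where yz: "y < 6" "z < 6" "card (supp y) = 2" "card (supp z) = 2" "supp y \<noteq> supp z" by blast
  have "{t. t < 6 \<and> supp t = supp y} \<inter> {t. t < 6 \<and> supp t = supp z} = {}" using yz(5) by blast
  thus ?thesis using matched_class[OF yz(1,3)] matched_class[OF yz(2,4)] by blast
next
  case False
  let ?D1 = "{z. z < 6 \<and> card (supp z) = 1}" and ?D2 = "{z. z < 6 \<and> card (supp z) = 2}"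
  have "card ?D2 \<le> 2"
  proof (cases "?D2 = {}")
    case nonempty: False
    then obtain y where y: "y < 6" "card (supp y) = 2" by auto
    have "?D2 \<subseteq> {z. z < 6 \<and> supp z = supp y}" using False y by blast
    hence "card ?D2 \<le> card {z. z < 6 \<and> supp z = supp y}" by (intro card_mono) auto
    thus ?thesis using card_supp_class[OF y(1)] y(2) by simp
  qed (simp only: card.empty)
  moreover have "?D1 \<union> ?D2 = {..<6}"
  proof -
    have "card (supp z) = 1 \<or> card (supp z) = 2" if "z < 6" for z
      using card_supp_le[OF that] supp_nonempty[OF that] by linarith
    thus ?thesis by auto
  qed
  hence "card {..<6::nat} \<le> card ?D1 + card ?D2" using card_Un_le[of ?D1 ?D2] by simp
  ultimately have D1: "card ?D1 \<ge> 4" by simp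
  then obtain A where A: "A \<subseteq> ?D1" "card A = 2" "finite A"
    using obtain_subset_with_card_n[of 2 ?D1] by auto
  have "card (?D1 - A) \<ge> 2" using D1 A by (simp add: card_Diff_subset)
  then obtain B where B: "B \<subseteq> ?D1 - A" "card B = 2"
    using obtain_subset_with_card_n[of 2 "?D1 - A"] by auto
  show ?thesis using matched_singletons[OF A(1,2)] matched_singletons[of B] B by blast
qed

end

subsection \<open>The action on antisymmetric matrices\<close>

text \<open>The six two-qubit Pauli operators with exactly one factor \<open>Y\<close>, in the order
  YI, YX, YZ, IY, XY, ZY; these are the antisymmetric ones.\<close>

definition asym_label :: "nat \<Rightarrow> (bool \<times> bool) list" where
  "asym_label x = [[(True, True), (False, False)], [(True, True), (True, False)], [(True, True), (False, True)],
     [(False, False), (True, True)], [(True, False), (True, True)], [(False, True), (True, True)]] ! x"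

text \<open>Column \<open>x\<close> is the row-major vectorization of the operator labelled
  \<open>asym_label x\<close>, written out so that the identities below become finite
  evaluations.\<close>

definition asym_table :: "complex list list" where
  "asym_table =
    [[0, 0, 0, 0, 0, 0], [0, 0, 0, -\<i>, 0, -\<i>], [-\<i>, 0, -\<i>, 0, 0, 0], [0, -\<i>, 0, 0, -\<i>, 0],
     [0, 0, 0, \<i>, 0, \<i>], [0, 0, 0, 0, 0, 0], [0, -\<i>, 0, 0, \<i>, 0], [-\<i>, 0, \<i>, 0, 0, 0],
     [\<i>, 0, \<i>, 0, 0, 0], [0, \<i>, 0, 0, -\<i>, 0], [0, 0, 0, 0, 0, 0], [0, 0, 0, -\<i>, 0, \<i>],
     [0, \<i>, 0, 0, \<i>, 0], [\<i>, 0, -\<i>, 0, 0, 0], [0, 0, 0, \<i>, 0, -\<i>], [0, 0, 0, 0, 0, 0]]"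

text \<open>The factor one half normalizes: a Pauli operator on two qubits has Hilbert-Schmidt norm
  2.\<close>

definition asym_basis :: "complex mat" where
  "asym_basis = mat 16 6 (\<lambda>(i, x). asym_table ! i ! x / 2)"

lemma asym_basis_carrier [simp]: "asym_basis \<in> carrier_mat 16 6"
  by (simp add: asym_basis_def)

lemma asym_basis_dim [simp]: "dim_row asym_basis = 16" "dim_col asym_basis = 6"
  by (simp_all add: asym_basis_def)

lemma all_less_4: "(\<forall>i<4. P i) \<longleftrightarrow> P 0 \<and> P 1 \<and> P 2 \<and> P 3"
  for P :: "nat \<Rightarrow> bool"
  by (simp add: numeral_eq_Suc All_less_Suc conj_commute conj_left_commute)

lemma all_less_6: "(\<forall>i<6. P i) \<longleftrightarrow> P 0 \<and> P 1 \<and> P 2 \<and> P 3 \<and> P 4 \<and> P 5"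
  for P :: "nat \<Rightarrow> bool"
  by (simp add: numeral_eq_Suc All_less_Suc conj_commute conj_left_commute)

lemma all_less_16: "(\<forall>i<16. P i) \<longleftrightarrow> P 0 \<and> P 1 \<and> P 2 \<and> P 3 \<and> P 4 \<and> P 5 \<and> P 6 \<and> P 7 \<and> P 8 \<and> P 9 \<and> P 10 \<and> P 11 \<and> P 12 \<and> P 13 \<and> P 14 \<and> P 15"
  for P :: "nat \<Rightarrow> bool"
  by (simp add: numeral_eq_Suc All_less_Suc conj_commute conj_left_commute)

lemma sum_less_6: "(\<Sum>i<6. f i) = f 0 + f 1 + f 2 + f 3 + f 4 + f 5"
  for f :: "nat \<Rightarrow> 'a::comm_monoid_add"
  by (simp add: eval_nat_numeral)

lemma sum_less_16: "(\<Sum>i<16. f i) = f 0 + f 1 + f 2 + f 3 + f 4 + f 5 + f 6 + f 7 + f 8 + f 9 + f 10 + f 11 + f 12 + f 13 + f 14 + f 15"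
  for f :: "nat \<Rightarrow> 'a::comm_monoid_add"
  by (simp add: eval_nat_numeral)

lemma length_asym_label [simp]: "x < 6 \<Longrightarrow> length (asym_label x) = 2"
proof -
  have "\<forall>x<6. length (asym_label x) = 2" by (simp add: all_less_6 asym_label_def)
  thus "x < 6 \<Longrightarrow> length (asym_label x) = 2" by blast
qed

lemma asym_table_ortho:
  "\<forall>x<6. \<forall>y<6. (\<Sum>i<16. cnj (asym_table ! i ! x) * asym_table ! i ! y) = (if x = y then 4 else 0)"
  by (simp add: all_less_6 sum_less_16 asym_table_def)

lemma asym_table_complete:
  "\<forall>i<16. \<forall>j<16. (\<Sum>x<6. asym_table ! i ! x * cnj (asym_table ! j ! x)) =
     (if i = j then 2 else 0) - (if i = 4 * (j mod 4) + j div 4 then 2 else 0)"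
  by (simp add: all_less_16 sum_less_6 asym_table_def)

lemma asym_table_pauli:
  "\<forall>x<6. \<forall>a<4. \<forall>b<4. asym_table ! (4 * a + b) ! x = pauli_op (asym_label x) $$ (a, b)"
  by (simp add: all_less_6 all_less_4 asym_table_def asym_label_def pauli1_index[folded One_nat_def] del: One_nat_def)

text \<open>The projector onto antisymmetric tensors, half of identity minus swap;
  \<open>4 * (j mod 4) + j div 4\<close> is the index \<open>j\<close> with its two tensor factors
  exchanged.\<close>

definition asymmetrizer :: "complex mat" where
  "asymmetrizer = mat 16 16 (\<lambda>(i, j).
     ((if i = j then 1 else 0) - (if i = 4 * (j mod 4) + j div 4 then 1 else 0)) / 2)"

lemma asymmetrizer_carrier [simp]: "asymmetrizer \<in> carrier_mat 16 16"
  by (simp add: asymmetrizer_def)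

lemma asymmetrizer_index:
  "i < 16 \<Longrightarrow> j < 16 \<Longrightarrow> asymmetrizer $$ (i, j) =
     ((if i = j then 1 else 0) - (if i = 4 * (j mod 4) + j div 4 then 1 else 0)) / 2"
  by (simp add: asymmetrizer_def)

lemma asymmetrizer_dim [simp]: "dim_row asymmetrizer = 16" "dim_col asymmetrizer = 16"
  by (simp_all add: asymmetrizer_def)

lemma asym_basis_ortho: "mat_adjoint asym_basis * asym_basis = 1\<^sub>m 6"
proof (rule eq_matI)
  fix x y assume "x < dim_row (1\<^sub>m 6 :: complex mat)" "y < dim_col (1\<^sub>m 6 :: complex mat)"
  hence xy: "x < 6" "y < 6" by auto
  have "(mat_adjoint asym_basis * asym_basis) $$ (x, y) =
      (\<Sum>i<16. cnj (asym_table ! i ! x) * asym_table ! i ! y) / 4"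
    using xy by (simp add: scalar_prod_def asym_basis_def sum_divide_distrib lessThan_atLeast0)
  also have "\<dots> = 1\<^sub>m 6 $$ (x, y)" using xy asym_table_ortho by simp
  finally show "(mat_adjoint asym_basis * asym_basis) $$ (x, y) = 1\<^sub>m 6 $$ (x, y)" .
qed auto

lemma asym_basis_complete: "asym_basis * mat_adjoint asym_basis = asymmetrizer"
proof (rule eq_matI)
  fix i j assume "i < dim_row asymmetrizer" "j < dim_col asymmetrizer"
  hence ij: "i < 16" "j < 16" by (auto simp: asymmetrizer_def)
  have "(asym_basis * mat_adjoint asym_basis) $$ (i, j) =
      (\<Sum>x<6. asym_table ! i ! x * cnj (asym_table ! j ! x)) / 4"
    using ij by (simp add: scalar_prod_def asym_basis_def sum_divide_distrib lessThan_atLeast0)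
  also have "\<dots> = asymmetrizer $$ (i, j)" using ij asym_table_complete by (simp add: asymmetrizer_def)
  finally show "(asym_basis * mat_adjoint asym_basis) $$ (i, j) = asymmetrizer $$ (i, j)" .
qed (auto simp: asymmetrizer_def)

lemma swap_index:
  assumes "(j::nat) < 16"
  shows "4 * (j mod 4) + j div 4 < 16" "(4 * (j mod 4) + j div 4) div 4 = j mod 4"
    "(4 * (j mod 4) + j div 4) mod 4 = j div 4"
    "i < 16 \<Longrightarrow> i = 4 * (j mod 4) + j div 4 \<longleftrightarrow> j = 4 * (i mod 4) + i div 4"
proof -
  have d: "j div 4 < 4" using assms by auto
  show 1: "(4 * (j mod 4) + j div 4) div 4 = j mod 4" "(4 * (j mod 4) + j div 4) mod 4 = j div 4"
    using d by auto
  show "4 * (j mod 4) + j div 4 < 16" using d mod_less_divisor[of 4 j] by linarith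
  show "i = 4 * (j mod 4) + j div 4 \<longleftrightarrow> j = 4 * (i mod 4) + i div 4" if "i < 16"
  proof -
    have d': "i div 4 < 4" using that by auto
    show ?thesis
    proof
      assume "i = 4 * (j mod 4) + j div 4"
      thus "j = 4 * (i mod 4) + i div 4" using 1 by simp
    next
      assume "j = 4 * (i mod 4) + i div 4"
      thus "i = 4 * (j mod 4) + j div 4" using d' by simp
    qed
  qed
qed

lemma kronecker_square_index:
  assumes "U \<in> carrier_mat 4 4" "i < 16" "j < 16"
  shows "kronecker U U $$ (i, j) = U $$ (i div 4, j div 4) * U $$ (i mod 4, j mod 4)"
  using assms by auto

lemma mult_asymmetrizer_index:
  assumes "K \<in> carrier_mat 16 16" "i < 16" "j < 16"
  shows "(K * asymmetrizer) $$ (i, j) = (K $$ (i, j) - K $$ (i, 4 * (j mod 4) + j div 4)) / 2"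
    "(asymmetrizer * K) $$ (i, j) = (K $$ (i, j) - K $$ (4 * (i mod 4) + i div 4, j)) / 2"
proof -
  define s where "s = (\<lambda>j::nat. 4 * (j mod 4) + j div 4)"
  have S: "asymmetrizer $$ (k, l) = ((if k = l then 1 else 0) - (if k = s l then 1 else 0)) / 2"
    if "k < 16" "l < 16" for k l using that by (simp add: asymmetrizer_def s_def)
  have S': "asymmetrizer $$ (k, l) = ((if l = k then 1 else 0) - (if l = s k then 1 else 0)) / 2"
    if kl: "k < 16" "l < 16" for k l
  proof -
    have "k = s l \<longleftrightarrow> l = s k" unfolding s_def by (rule swap_index(4)[OF kl(2) kl(1)])
    thus ?thesis unfolding S[OF kl] by simp
  qed
  have s: "s j < 16" "s i < 16" using swap_index(1) assms unfolding s_def by blast+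
  have "(K * asymmetrizer) $$ (i, j) = (\<Sum>k<16. K $$ (i, k) * asymmetrizer $$ (k, j))"
    using assms by (simp add: scalar_prod_def lessThan_atLeast0)
  also have "\<dots> = (\<Sum>k<16. (if k = j then K $$ (i, k) / 2 else 0) - (if k = s j then K $$ (i, k) / 2 else 0))"
    using assms(3) by (intro sum.cong) (simp_all add: S right_diff_distrib diff_divide_distrib)
  also have "\<dots> = (K $$ (i, j) - K $$ (i, s j)) / 2"
    using assms s by (simp add: sum_subtractf diff_divide_distrib)
  finally show "(K * asymmetrizer) $$ (i, j) = (K $$ (i, j) - K $$ (i, 4 * (j mod 4) + j div 4)) / 2"
    unfolding s_def .
  have "(asymmetrizer * K) $$ (i, j) = (\<Sum>k<16. asymmetrizer $$ (i, k) * K $$ (k, j))"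
    using assms by (simp add: scalar_prod_def lessThan_atLeast0)
  also have "\<dots> = (\<Sum>k<16. (if k = i then K $$ (k, j) / 2 else 0) - (if k = s i then K $$ (k, j) / 2 else 0))"
    using assms(2) by (intro sum.cong) (simp_all add: S' left_diff_distrib diff_divide_distrib)
  also have "\<dots> = (K $$ (i, j) - K $$ (s i, j)) / 2"
    using assms s by (simp add: sum_subtractf diff_divide_distrib)
  finally show "(asymmetrizer * K) $$ (i, j) = (K $$ (i, j) - K $$ (4 * (i mod 4) + i div 4, j)) / 2"
    unfolding s_def .
qed

text \<open>Exchanging the factors in both indices of an entry of \<open>kronecker U U\<close> only
  permutes a product of two numbers.\<close>

lemma asymmetrizer_comm:
  assumes "U \<in> carrier_mat 4 4"
  shows "asymmetrizer * kronecker U U = kronecker U U * asymmetrizer"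
proof (rule eq_matI)
  have K: "kronecker U U \<in> carrier_mat 16 16" using kronecker_carrier[OF assms assms] by simp
  fix i j assume "i < dim_row (kronecker U U * asymmetrizer)" "j < dim_col (kronecker U U * asymmetrizer)"
  hence ij: "i < 16" "j < 16" using assms by (auto simp: asymmetrizer_def)
  show "(asymmetrizer * kronecker U U) $$ (i, j) = (kronecker U U * asymmetrizer) $$ (i, j)"
    using ij swap_index[OF ij(1)] swap_index[OF ij(2)]
    by (simp only: mult_asymmetrizer_index[OF K] kronecker_square_index[OF assms] mult.commute)
qed (use assms in \<open>auto simp: asymmetrizer_def\<close>)

text \<open>The second exterior power of \<open>U\<close>. On row-major vectorizations
  \<open>kronecker U U\<close> is the map from \<open>A\<close> to \<open>U A U^T\<close>, here
  compressed to the antisymmetric matrices.\<close>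

definition asym_rep :: "complex mat \<Rightarrow> complex mat" where
  "asym_rep U = mat_adjoint asym_basis * (kronecker U U * asym_basis)"

lemma kronecker_square_carrier: 
  assumes U: "U \<in> carrier_mat 4 4"
  shows "kronecker U U \<in> carrier_mat 16 16"
  using kronecker_carrier[OF U U] by simp

lemma asym_rep_carrier: 
  assumes U: "U \<in> carrier_mat 4 4"
  shows "asym_rep U \<in> carrier_mat 6 6"
  unfolding asym_rep_def using kronecker_square_carrier[OF U]
  by (meson asym_basis_carrier mat_adjoint_carrier mult_carrier_mat)

text \<open>\<open>kronecker U U\<close> commutes with the projector and so preserves its range; the
  compression loses nothing there. Multiplicativity of \<open>asym_rep\<close> rests on
  this.\<close>

lemma asym_basis_rep: 
  assumes U: "U \<in> carrier_mat 4 4"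
  shows "asym_basis * asym_rep U = kronecker U U * asym_basis"
proof -
  note K = kronecker_square_carrier[OF U]
  have c: "mat_adjoint asym_basis \<in> carrier_mat 6 16" by simp
  have KB: "kronecker U U * asym_basis \<in> carrier_mat 16 6" using K by (rule mult_carrier_mat) simp
  have "asym_basis * asym_rep U = asymmetrizer * (kronecker U U * asym_basis)"
    unfolding asym_rep_def asym_basis_complete[symmetric]
    by (rule assoc_mult_mat[symmetric, OF asym_basis_carrier c KB])
  also have "\<dots> = asymmetrizer * kronecker U U * asym_basis"
    by (rule assoc_mult_mat[symmetric, OF asymmetrizer_carrier K asym_basis_carrier])
  also have "\<dots> = kronecker U U * (asymmetrizer * asym_basis)"
    unfolding asymmetrizer_comm[OF U] by (rule assoc_mult_mat[OF K asymmetrizer_carrier asym_basis_carrier])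
  also have "asymmetrizer * asym_basis = asym_basis * (mat_adjoint asym_basis * asym_basis)"
    unfolding asym_basis_complete[symmetric] by (rule assoc_mult_mat[OF asym_basis_carrier c asym_basis_carrier])
  finally show ?thesis by (simp add: asym_basis_ortho)
qed

lemma asym_rep_adjoint: 
  assumes U: "U \<in> carrier_mat 4 4"
  shows "asym_rep (mat_adjoint U) = mat_adjoint (asym_rep U)"
proof -
  note K = kronecker_square_carrier[OF U]
  have c: "mat_adjoint asym_basis \<in> carrier_mat 6 16" by simp
  have KB: "kronecker U U * asym_basis \<in> carrier_mat 16 6" using K by (rule mult_carrier_mat) simp
  show ?thesis unfolding asym_rep_def mat_adjoint_mult[OF c KB] mat_adjoint_mult[OF K asym_basis_carrier]
      kronecker_adjoint mat_adjoint_adjoint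
    using assoc_mult_mat[OF c _ asym_basis_carrier, of "kronecker (mat_adjoint U) (mat_adjoint U)"]
      mat_adjoint_carrier[OF K] by (simp add: kronecker_adjoint)
qed

lemma asym_rep_smult: 
  assumes U: "U \<in> carrier_mat 4 4"
  shows "asym_rep (c \<cdot>\<^sub>m U) = (c * c) \<cdot>\<^sub>m asym_rep U"
proof -
  note K = kronecker_square_carrier[OF U]
  have c: "mat_adjoint asym_basis \<in> carrier_mat 6 16" by simp
  have KB: "kronecker U U * asym_basis \<in> carrier_mat 16 6" using K by (rule mult_carrier_mat) simp
  show ?thesis unfolding asym_rep_def kronecker_smult
    by (simp only: mult_smult_assoc_mat[OF K asym_basis_carrier] mult_smult_distrib[OF c KB])
qed

lemma asym_rep_eqI:
  assumes U: "U \<in> carrier_mat 4 4" and "R \<in> carrier_mat 6 6" "kronecker U U * asym_basis = asym_basis * R"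
  shows "asym_rep U = R"
proof -
  have c: "mat_adjoint asym_basis \<in> carrier_mat 6 16" by simp
  have "asym_rep U = mat_adjoint asym_basis * asym_basis * R"
    unfolding asym_rep_def assms(3) by (rule assoc_mult_mat[symmetric, OF c asym_basis_carrier assms(2)])
  thus ?thesis using assms(2) by (simp add: asym_basis_ortho)
qed

lemma asym_rep_mult:
  assumes "U \<in> carrier_mat 4 4" "V \<in> carrier_mat 4 4"
  shows "asym_rep (U * V) = asym_rep U * asym_rep V"
proof (rule asym_rep_eqI)
  note K = kronecker_square_carrier[OF assms(1)] and L = kronecker_square_carrier[OF assms(2)]
    and R = asym_rep_carrier[OF assms(1)] and S = asym_rep_carrier[OF assms(2)]
  show "U * V \<in> carrier_mat 4 4" "asym_rep U * asym_rep V \<in> carrier_mat 6 6" using assms R S by auto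
  have "kronecker (U * V) (U * V) * asym_basis = kronecker U U * (kronecker V V * asym_basis)"
    unfolding kronecker_mult[OF assms assms, symmetric] by (rule assoc_mult_mat[OF K L asym_basis_carrier])
  also have "\<dots> = kronecker U U * asym_basis * asym_rep V"
    unfolding asym_basis_rep[OF assms(2), symmetric] by (rule assoc_mult_mat[symmetric, OF K asym_basis_carrier S])
  also have "\<dots> = asym_basis * (asym_rep U * asym_rep V)"
    unfolding asym_basis_rep[OF assms(1), symmetric] by (rule assoc_mult_mat[OF asym_basis_carrier R S])
  finally show "kronecker (U * V) (U * V) * asym_basis = asym_basis * (asym_rep U * asym_rep V)" .
qed

lemma asym_rep_one: "asym_rep (1\<^sub>m 4) = 1\<^sub>m 6"
  using kronecker_one[of 4 4] left_mult_one_mat[OF asym_basis_carrier] right_mult_one_mat[OF asym_basis_carrier]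
  by (intro asym_rep_eqI) auto

lemma pair4_eq: "b < 4 \<Longrightarrow> d < 4 \<Longrightarrow> 4 * a + b = 4 * c + d \<longleftrightarrow> a = c \<and> b = (d :: nat)"
  by presburger

text \<open>The entries of the exterior power encode the two by two minors, so the minor of rows
  \<open>p, q\<close> and columns \<open>r, s\<close> vanishes unless the two index pairs agree as
  sets. This forces \<open>X\<close> to be scalar, and operators with equal images can then be
  compared.\<close>

lemma asym_rep_scalar:
  assumes X: "X \<in> carrier_mat 4 4" and rep: "asym_rep X = c \<cdot>\<^sub>m 1\<^sub>m 6" and "c \<noteq> 0"
  shows "\<exists>d. X = d \<cdot>\<^sub>m 1\<^sub>m 4"
proof -
  note K = kronecker_square_carrier[OF X]
  have a: "mat_adjoint asym_basis \<in> carrier_mat 6 16" by simp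
  have "kronecker X X * asymmetrizer = asym_basis * (c \<cdot>\<^sub>m 1\<^sub>m 6) * mat_adjoint asym_basis"
    unfolding asym_basis_complete[symmetric] rep[symmetric] asym_basis_rep[OF X]
    by (rule assoc_mult_mat[symmetric, OF K asym_basis_carrier a])
  also have "\<dots> = c \<cdot>\<^sub>m asymmetrizer"
    using mult_smult_distrib[OF asym_basis_carrier one_carrier_mat, of c] mult_smult_assoc_mat[OF asym_basis_carrier a, of c]
      right_mult_one_mat[OF asym_basis_carrier]
    by (simp add: asym_basis_complete)
  finally have KS: "kronecker X X * asymmetrizer = c \<cdot>\<^sub>m asymmetrizer" .
  have halves: "a = d * b" if "a / 2 = d * (b / 2)" for a b d :: complex
    using that by simp
  have minor: "X $$ (p, r) * X $$ (q, s) - X $$ (p, s) * X $$ (q, r) =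
      c * ((if p = r \<and> q = s then 1 else 0) - (if p = s \<and> q = r then 1 else 0))"
    if pq: "p < 4" "q < 4" "r < 4" "s < 4" for p q r s
  proof -
    let ?i = "4 * p + q" and ?j = "4 * r + s"
    have pair: "4 * a + b < 16" "(4 * a + b) div 4 = a" "(4 * a + b) mod 4 = b" if "a < 4" "b < 4" for a b :: nat
      using that by simp_all
    note i = pair[OF pq(1,2)] and j = pair[OF pq(3,4)] and k = pair[OF pq(4,3)]
    have eq: "?i = ?j \<longleftrightarrow> p = r \<and> q = s" "?i = 4 * s + r \<longleftrightarrow> p = s \<and> q = r"
      using pq by (simp_all only: pair4_eq)
    have "(kronecker X X * asymmetrizer) $$ (?i, ?j) = c * asymmetrizer $$ (?i, ?j)"
      unfolding KS by (rule index_smult_mat(1)) (simp_all only: asymmetrizer_dim i(1) j(1))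
    hence "(X $$ (p, r) * X $$ (q, s) - X $$ (p, s) * X $$ (q, r)) / 2 =
        c * (((if p = r \<and> q = s then 1 else 0) - (if p = s \<and> q = r then 1 else 0)) / 2)"
      by (simp only: mult_asymmetrizer_index(1)[OF K i(1) j(1)] asymmetrizer_index[OF i(1) j(1)] i(2,3) j(2,3) k(2,3)
        kronecker_square_index[OF X i(1) j(1)] kronecker_square_index[OF X i(1) k(1)] eq)
    thus ?thesis by (rule halves)
  qed
  have third: "\<exists>l<4. l \<noteq> a \<and> l \<noteq> b" for a b :: nat
  proof (rule ccontr)
    assume "\<not> ?thesis"
    hence "card {..<4::nat} \<le> card {a, b}" by (intro card_mono) auto
    thus False using card_insert_le_m1[of 2 "{b}" a] by simp
  qed
  \<comment> \<open>Rows \<open>p\<close> and \<open>j\<close> never match the columns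
    \<open>k\<close> and \<open>l\<close>, so these minors vanish. If \<open>X $$ (p, k)\<close>
    were nonzero, columns \<open>k\<close> and \<open>l\<close> would be proportional and their
    principal minor, which is \<open>c\<close>, would vanish.\<close>
  have off: "X $$ (p, k) = 0" if pk: "p < 4" "k < 4" "p \<noteq> k" for p k
  proof (rule ccontr)
    assume nz: "X $$ (p, k) \<noteq> 0"
    obtain l where l: "l < 4" "l \<noteq> p" "l \<noteq> k" using third by blast
    have *: "X $$ (p, k) * X $$ (j, l) = X $$ (p, l) * X $$ (j, k)" if "j < 4" for j
      using minor[OF pk(1) that pk(2) l(1)] pk l by (simp split: if_splits)
    have c: "c = X $$ (k, k) * X $$ (l, l) - X $$ (k, l) * X $$ (l, k)"
      using minor[OF pk(2) l(1) pk(2) l(1)] l by simp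
    have "X $$ (p, k) * c = X $$ (k, k) * (X $$ (p, k) * X $$ (l, l)) - (X $$ (p, k) * X $$ (k, l)) * X $$ (l, k)"
      unfolding c by (simp add: algebra_simps)
    also have "\<dots> = 0" unfolding *[OF l(1)] *[OF pk(2)] by (simp add: algebra_simps)
    finally show False using nz \<open>c \<noteq> 0\<close> by simp
  qed
  have prod: "X $$ (p, p) * X $$ (q, q) = c" if "p < 4" "q < 4" "p \<noteq> q" for p q
    using minor[OF that(1,2,1,2)] off[OF that] that(3) by simp
  \<comment> \<open>Diagonal entries at different positions have product \<open>c\<close>; comparing
    \<open>p\<close> and 0 through a third index \<open>l\<close> gives equality.\<close>
  have diag: "X $$ (p, p) = X $$ (0, 0)" if p: "p < 4" for p
  proof (cases "p = 0")
    case False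
    obtain l where l: "l < 4" "l \<noteq> p" "l \<noteq> 0" using third by blast
    have "X $$ (p, p) * X $$ (l, l) = X $$ (0, 0) * X $$ (l, l)" "X $$ (0, 0) * X $$ (l, l) \<noteq> 0"
      using prod[OF p l(1)] prod[of 0 l] l \<open>c \<noteq> 0\<close> by auto
    thus ?thesis by simp
  qed simp
  have "X = X $$ (0, 0) \<cdot>\<^sub>m 1\<^sub>m 4"
  proof (rule eq_matI)
    fix i j assume "i < dim_row (X $$ (0, 0) \<cdot>\<^sub>m 1\<^sub>m 4)" "j < dim_col (X $$ (0, 0) \<cdot>\<^sub>m 1\<^sub>m 4)"
    hence ij: "i < 4" "j < 4" by auto
    show "X $$ (i, j) = (X $$ (0, 0) \<cdot>\<^sub>m 1\<^sub>m 4) $$ (i, j)"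
    proof (cases "i = j")
      case True
      thus ?thesis using diag[OF ij(1)] ij by simp
    qed (use off[OF ij] ij in simp)
  qed (use X in auto)
  thus ?thesis ..
qed

section \<open>Pauli operators acting on antisymmetric matrices\<close>

lemma pauli_op_carrier4 [simp]: "length v = 2 \<Longrightarrow> pauli_op v \<in> carrier_mat 4 4"
  using pauli_op_carrier'[of v 2] by simp

text \<open>Of the four Pauli matrices only \<open>Y\<close> changes sign under transposition, so
  this is the parity of the number of factors \<open>Y\<close>.\<close>

fun transpose_sign :: "(bool \<times> bool) list \<Rightarrow> complex" where
  "transpose_sign (p # v) = (if fst p \<and> snd p then - 1 else 1) * transpose_sign v"
| "transpose_sign [] = 1"

lemma pauli1_transpose:
  "transpose_mat (pauli1 p) = (if fst p \<and> snd p then - 1 else 1) \<cdot>\<^sub>m pauli1 p"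
  by (rule mat2_eqI; cases p; cases "fst p"; cases "snd p") (simp_all add: pauli1_index)

lemma kronecker_transpose:
  "transpose_mat (kronecker A B) = kronecker (transpose_mat A) (transpose_mat B)"
proof (rule eq_matI)
  fix i j assume "i < dim_row (kronecker (transpose_mat A) (transpose_mat B))"
    "j < dim_col (kronecker (transpose_mat A) (transpose_mat B))"
  hence "i < dim_col A * dim_col B" "j < dim_row A * dim_row B" by auto
  thus "transpose_mat (kronecker A B) $$ (i, j) = kronecker (transpose_mat A) (transpose_mat B) $$ (i, j)"
    by (simp add: div_mod_less[of i] div_mod_less[of j])
qed auto

lemma pauli_op_transpose: "transpose_mat (pauli_op v) = transpose_sign v \<cdot>\<^sub>m pauli_op v"
proof (induction v)
  case Nil
  show ?case by (simp add: one_smult)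
next
  case (Cons p v)
  thus ?case by (simp only: pauli_op_simps kronecker_transpose pauli1_transpose transpose_sign.simps kronecker_smult)
qed

text \<open>The eigenvalue of the map from \<open>A\<close> to \<open>W A W^T\<close> on the basis
  operator \<open>x\<close>: replacing \<open>W^T\<close> by \<open>W\<close> costs the transpose
  sign, and moving \<open>W\<close> past the basis operator costs the commutation sign.\<close>

definition pauli_sign :: "(bool \<times> bool) list \<Rightarrow> nat \<Rightarrow> complex" where
  "pauli_sign v x = comm_sign (asym_label x) v * transpose_sign v"

definition pauli_diag :: "(bool \<times> bool) list \<Rightarrow> complex mat" where
  "pauli_diag v = mat 6 6 (\<lambda>(x, y). if x = y then pauli_sign v x else 0)"

lemma pauli_diag_carrier [simp]: "pauli_diag v \<in> carrier_mat 6 6"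
  by (simp add: pauli_diag_def)

lemma asym_basis_index:
  assumes "i < 16" "x < 6"
  shows "asym_basis $$ (i, x) = pauli_op (asym_label x) $$ (i div 4, i mod 4) / 2"
proof -
  have "i div 4 < 4" "i mod 4 < 4" using assms(1) by auto
  hence "asym_table ! (4 * (i div 4) + i mod 4) ! x = pauli_op (asym_label x) $$ (i div 4, i mod 4)"
    using asym_table_pauli assms(2) by blast
  moreover have "4 * (i div 4) + i mod 4 = i" by simp
  ultimately show ?thesis using assms by (simp add: asym_basis_def)
qed

lemma asym_rep_pauli_op:
  assumes v: "length v = 2"
  shows "asym_rep (pauli_op v) = pauli_diag v"
proof (rule asym_rep_eqI)
  let ?W = "pauli_op v"
  show W: "?W \<in> carrier_mat 4 4" and "pauli_diag v \<in> carrier_mat 6 6" using v by simp_all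
  note K = kronecker_square_carrier[OF W]
  show "kronecker ?W ?W * asym_basis = asym_basis * pauli_diag v"
  proof (rule eq_matI)
    fix i x assume "i < dim_row (asym_basis * pauli_diag v)" "x < dim_col (asym_basis * pauli_diag v)"
    hence ix: "i < 16" "x < 6" by (auto simp: pauli_diag_def)
    let ?B = "pauli_op (asym_label x)" and ?p = "i div 4" and ?q = "i mod 4"
    have B: "?B \<in> carrier_mat 4 4" using ix by simp
    have pq: "?p < 4" "?q < 4" using ix(1) by auto
    have tr: "?W $$ (?q, b) = transpose_sign v * ?W $$ (b, ?q)" if "b < 4" for b
      using arg_cong[OF pauli_op_transpose[of v], of "\<lambda>M. M $$ (b, ?q)"] W that pq by simp
    have WBW: "?W * (?B * ?W) = comm_sign (asym_label x) v \<cdot>\<^sub>m ?B"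
    proof -
      have "?B * ?W = comm_sign (asym_label x) v \<cdot>\<^sub>m (?W * ?B)" using pauli_op_comm[of "asym_label x" v] v ix by simp
      hence "?W * (?B * ?W) = comm_sign (asym_label x) v \<cdot>\<^sub>m (?W * ?W * ?B)"
        using smult_mult(2)[OF W mat_sq_mult[OF W B]] mat_assoc[OF W W B] by simp
      thus ?thesis using pauli_op_square[of v] v B by simp
    qed
    \<comment> \<open>Reading \<open>i\<close> as the position \<open>(?p, ?q)\<close>, the sum is
      half the entry of \<open>W B W^T\<close> there; \<open>tr\<close> removes the transpose and
      \<open>WBW\<close> evaluates the rest.\<close>
    have "(kronecker ?W ?W * asym_basis) $$ (i, x) = (\<Sum>k<16. kronecker ?W ?W $$ (i, k) * asym_basis $$ (k, x))"
      using ix W by (simp add: scalar_prod_def lessThan_atLeast0 del: kronecker_index)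
    also have "\<dots> = (\<Sum>k<4 * 4. ?W $$ (?p, k div 4) * ?W $$ (?q, k mod 4) * (?B $$ (k div 4, k mod 4) / 2))"
      by (intro sum.cong) (simp_all add: kronecker_square_index[OF W ix(1)] asym_basis_index[OF _ ix(2)] del: kronecker_index)
    also have "\<dots> = (\<Sum>a<4. \<Sum>b<4. ?W $$ (?p, a) * ?W $$ (?q, b) * (?B $$ (a, b) / 2))"
      by (rule sum_div_mod)
    also have "\<dots> = (\<Sum>a<4. \<Sum>b<4. transpose_sign v / 2 * (?W $$ (?p, a) * (?B $$ (a, b) * ?W $$ (b, ?q))))"
      by (intro sum.cong refl) (simp add: tr)
    also have "\<dots> = transpose_sign v / 2 * (\<Sum>a<4. ?W $$ (?p, a) * (\<Sum>b<4. ?B $$ (a, b) * ?W $$ (b, ?q)))"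
      by (simp add: sum_distrib_left)
    also have "(\<Sum>a<4. ?W $$ (?p, a) * (\<Sum>b<4. ?B $$ (a, b) * ?W $$ (b, ?q))) = (?W * (?B * ?W)) $$ (?p, ?q)"
      using W B pq by (simp add: scalar_prod_def lessThan_atLeast0)
    also have "\<dots> = comm_sign (asym_label x) v * ?B $$ (?p, ?q)" unfolding WBW using B pq by simp
    also have "transpose_sign v / 2 * \<dots> = asym_basis $$ (i, x) * pauli_sign v x"
      by (simp add: asym_basis_index[OF ix] pauli_sign_def)
    also have "\<dots> = (\<Sum>y<6. if y = x then asym_basis $$ (i, y) * pauli_sign v y else 0)"
      using ix by simp
    also have "\<dots> = (\<Sum>y<6. asym_basis $$ (i, y) * pauli_diag v $$ (y, x))"
      using ix by (intro sum.cong) (auto simp: pauli_diag_def)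
    also have "\<dots> = (asym_basis * pauli_diag v) $$ (i, x)"
      using ix by (simp add: scalar_prod_def lessThan_atLeast0 pauli_diag_def)
    finally show "(kronecker ?W ?W * asym_basis) $$ (i, x) = (asym_basis * pauli_diag v) $$ (i, x)" .
  qed (use W in \<open>auto simp: pauli_diag_def\<close>)
qed

text \<open>The fifteen nonidentity labels correspond to the fifteen two-element subsets of six
  points: the entry at \<open>i\<close>, \<open>j\<close> is the label with eigenvalue 1 exactly on
  these two basis vectors. The empty lists on the diagonal are placeholders.\<close>

definition duad_label :: "nat \<Rightarrow> nat \<Rightarrow> (bool \<times> bool) list" where
  "duad_label i j = (let f = False; t = True in
    [[[], [(f, f), (t, f)], [(f, f), (f, t)], [(t, t), (t, t)], [(f, t), (t, t)], [(t, f), (t, t)]],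
     [[(f, f), (t, f)], [], [(f, f), (t, t)], [(t, t), (f, t)], [(f, t), (f, t)], [(t, f), (f, t)]],
     [[(f, f), (f, t)], [(f, f), (t, t)], [], [(t, t), (t, f)], [(f, t), (t, f)], [(t, f), (t, f)]],
     [[(t, t), (t, t)], [(t, t), (f, t)], [(t, t), (t, f)], [], [(t, f), (f, f)], [(f, t), (f, f)]],
     [[(f, t), (t, t)], [(f, t), (f, t)], [(f, t), (t, f)], [(t, f), (f, f)], [], [(t, t), (f, f)]],
     [[(t, f), (t, t)], [(t, f), (f, t)], [(t, f), (t, f)], [(f, t), (f, f)], [(t, t), (f, f)], []]] ! i ! j)"

lemma asym_label_simps [simp]:
  "asym_label 0 = [(True, True), (False, False)]" "asym_label 1 = [(True, True), (True, False)]"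
  "asym_label 2 = [(True, True), (False, True)]" "asym_label 3 = [(False, False), (True, True)]"
  "asym_label 4 = [(True, False), (True, True)]" "asym_label 5 = [(False, True), (True, True)]"
  by (simp_all add: asym_label_def)

lemma duad_label:
  "\<forall>i<6. \<forall>j<6. i \<noteq> j \<longrightarrow> length (duad_label i j) = 2 \<and>
     (\<forall>x<6. pauli_sign (duad_label i j) x = (if x = i \<or> x = j then 1 else - 1))"
  by (simp add: all_less_6 duad_label_def pauli_sign_def sign1_def del: One_nat_def)

lemma duad_exists:
  assumes "A \<subseteq> {..<6}" "card A = 2"
  obtains v where "length v = 2" "\<And>x. x < 6 \<Longrightarrow> pauli_sign v x = (if x \<in> A then 1 else - 1)"
proof -
  obtain i j where A: "A = {i, j}" "i \<noteq> j" using assms(2) by (auto simp: card_2_iff)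
  hence "i < 6" "j < 6" using assms(1) by auto
  thus ?thesis using that[of "duad_label i j"] duad_label A by simp
qed

lemma zlab_2: "zlab 2 = [(False, False), (False, False)]"
  by (simp add: numeral_2_eq_2)

lemma length_2_label:
  assumes "length (v :: (bool \<times> bool) list) = 2"
  obtains a b c d where "v = [(a, b), (c, d)]"
  using assms by (auto simp: numeral_2_eq_2 length_Suc_conv)

text \<open>Under the correspondence with pairs of points, commuting means disjoint. All label pairs
  are checked.\<close>

lemma pauli_sign_comm:
  assumes "length v = 2" "length w = 2" "v \<noteq> zlab 2" "w \<noteq> zlab 2" "v \<noteq> w"
  shows "comm_sign v w = 1 \<longleftrightarrow> (\<forall>x<6. \<not> (pauli_sign v x = 1 \<and> pauli_sign w x = 1))"
proof -
  obtain a b c d where v: "v = [(a, b), (c, d)]" using assms(1) by (rule length_2_label)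
  obtain a' b' c' d' where w: "w = [(a', b'), (c', d')]" using assms(2) by (rule length_2_label)
  show ?thesis using assms(3-5) unfolding v w all_less_6
    by (cases a; cases b; cases c; cases d; cases a'; cases b'; cases c'; cases d')
      (simp_all add: zlab_2 pauli_sign_def sign1_def del: One_nat_def)
qed

lemma card_pauli_sign:
  assumes "length v = 2" "v \<noteq> zlab 2"
  shows "card {x. x < 6 \<and> pauli_sign v x = 1} = 2"
proof -
  obtain a b c d where v: "v = [(a, b), (c, d)]" using assms(1) by (rule length_2_label)
  have "card {x \<in> {..<6}. pauli_sign v x = 1} = (\<Sum>x<6. if pauli_sign v x = 1 then 1 else 0)"
    by (rule card_filter) simp
  also have "\<dots> = 2"
    using assms(2) unfolding v sum_less_6
    by (cases a; cases b; cases c; cases d)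
      (simp_all add: zlab_2 pauli_sign_def sign1_def del: One_nat_def)
  finally show ?thesis by simp
qed

text \<open>A further label \<open>u\<close> commuting with both would make \<open>v\<close>,
  \<open>w\<close>, \<open>u\<close> and \<open>lxor v w\<close> four distinct commuting labels,
  hence give four disjoint pairs among six points.\<close>

lemma lagrangian_2:
  assumes "length v = 2" "length w = 2" "v \<noteq> zlab 2" "w \<noteq> zlab 2" "v \<noteq> w" "comm_sign v w = 1"
  shows "lagrangian 2 v w"
proof -
  have "u \<in> {zlab 2, v, w, lxor v w}" if u: "length u = 2" "comm_sign u v = 1" "comm_sign u w = 1" for u
  proof (rule ccontr)
    assume *: "\<not> ?thesis"
    let ?S = "\<lambda>v. {x. x < 6 \<and> pauli_sign v x = 1}"
    have disj: "?S s \<inter> ?S t = {}"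
      if "length s = 2" "length t = 2" "s \<noteq> zlab 2" "t \<noteq> zlab 2" "s \<noteq> t" "comm_sign s t = 1" for s t
      using pauli_sign_comm[OF that(1-5)] that(6) by auto
    let ?t = "lxor v w"
    have t: "?t \<noteq> zlab 2" "?t \<noteq> v" "?t \<noteq> w" "length ?t = 2"
      using assms lxor_cancel[of v w] lxor_cancel'[of v w] by auto
    have c: "comm_sign ?t v = 1" "comm_sign ?t w = 1" "comm_sign ?t u = 1"
      using comm_sign_lxor[of v w] assms u comm_sign_sym[of w v] comm_sign_sym[of v u] comm_sign_sym[of w u]
      by auto
    have d: "?S v \<inter> ?S w = {}" "?S u \<inter> ?S v = {}" "?S u \<inter> ?S w = {}"
      "?S ?t \<inter> ?S v = {}" "?S ?t \<inter> ?S w = {}" "?S ?t \<inter> ?S u = {}"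
      using assms u * t c by (intro disj; blast)+
    have "card (?S v \<union> ?S w) = 4" "card (?S u \<union> ?S ?t) = 4"
      using d card_pauli_sign assms u * t by (subst card_Un_disjoint; fastforce)+
    moreover have "(?S v \<union> ?S w) \<inter> (?S u \<union> ?S ?t) = {}" using d by blast
    ultimately have "card ((?S v \<union> ?S w) \<union> (?S u \<union> ?S ?t)) = 8"
      by (subst card_Un_disjoint) auto
    moreover have "card ((?S v \<union> ?S w) \<union> (?S u \<union> ?S ?t)) \<le> card {..<6::nat}"
      by (intro card_mono) auto
    ultimately show False by simp
  qed
  thus ?thesis using assms by (simp add: lagrangian_def)
qed

subsection \<open>The Clifford hierarchy\<close>

definition commuting_pair :: "(bool \<times> bool) list \<Rightarrow> (bool \<times> bool) list \<Rightarrow> bool" where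
  "commuting_pair v w \<longleftrightarrow> length v = 2 \<and> length w = 2 \<and> v \<noteq> zlab 2 \<and> w \<noteq> zlab 2 \<and> v \<noteq> w \<and> comm_sign v w = 1"

definition maps_pauli :: "nat \<Rightarrow> complex mat \<Rightarrow> (bool \<times> bool) list \<Rightarrow> bool" where
  "maps_pauli n U v \<longleftrightarrow> (\<exists>c\<in>phases. \<exists>v'. length v' = n \<and> conj_by U (pauli_op v) = c \<cdot>\<^sub>m pauli_op v')"

text \<open>The invariant of the induction on the level: the semi-Clifford property for two qubits,
  stated through two generators.\<close>

definition maps_pauli_pair :: "complex mat \<Rightarrow> bool" where
  "maps_pauli_pair U \<longleftrightarrow> unitary_gate 2 U \<and> (\<exists>v w. commuting_pair v w \<and> maps_pauli 2 U v \<and> maps_pauli 2 U w)"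

text \<open>The images of the two generators are again commuting, distinct and different from the
  identity, so both pairs are Lagrangian.\<close>

lemma maps_pauli_pair_semi_clifford:
  assumes "maps_pauli_pair U"
  shows "semi_clifford 2 U"
proof -
  obtain v w c v' d w' where U: "unitary_gate 2 U" and vw: "commuting_pair v w"
    and c: "c \<in> phases" "length v' = 2" "conj_by U (pauli_op v) = c \<cdot>\<^sub>m pauli_op v'"
    and d: "d \<in> phases" "length w' = 2" "conj_by U (pauli_op w) = d \<cdot>\<^sub>m pauli_op w'"
    using assms unfolding maps_pauli_pair_def maps_pauli_def by blast
  from vw have len: "length v = 2" "length w = 2" and nz: "v \<noteq> zlab 2" "w \<noteq> zlab 2" "v \<noteq> w"
    and comm: "comm_sign v w = 1" by (auto simp: commuting_pair_def)
  have "v' \<noteq> zlab 2"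
    using conj_scalar_pauli_op[OF U, of v c] c(3) len(1) nz(1) pauli_op_zero[of 2] by auto
  moreover have "w' \<noteq> zlab 2"
    using conj_scalar_pauli_op[OF U, of w d] d(3) len(2) nz(2) pauli_op_zero[of 2] by auto
  moreover have "v' \<noteq> w'"
  \<comment> \<open>Equal images would make the conjugate of the product a scalar, because Pauli
    operators square to the identity; then \<open>lxor v w\<close> would be zero.\<close>
  proof
    assume eq: "v' = w'"
    obtain e where e: "e \<in> phases" "pauli_op v * pauli_op w = e \<cdot>\<^sub>m pauli_op (lxor v w)"
      using pauli_op_mult[of v w] len by auto
    have "e \<cdot>\<^sub>m conj_by U (pauli_op (lxor v w)) = conj_by U (pauli_op v * pauli_op w)"
      unfolding e(2) using conj_by_smult[OF U] len by simp
    also have "\<dots> = (c \<cdot>\<^sub>m pauli_op v') * (d \<cdot>\<^sub>m pauli_op v')"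
      using conj_by_mult[OF U, of "pauli_op v" "pauli_op w"] len c(3) d(3) eq by simp
    also have "\<dots> = (c * d) \<cdot>\<^sub>m 1\<^sub>m (2 ^ 2)"
      using smult_mult(3)[of "pauli_op v'" 4] pauli_op_square[of v'] c(2) by simp
    finally have "cnj e \<cdot>\<^sub>m (e \<cdot>\<^sub>m conj_by U (pauli_op (lxor v w))) = (cnj e * (c * d)) \<cdot>\<^sub>m 1\<^sub>m (2 ^ 2)"
      by (simp add: smult_smult)
    hence "conj_by U (pauli_op (lxor v w)) = (cnj e * (c * d)) \<cdot>\<^sub>m 1\<^sub>m (2 ^ 2)"
      unfolding smult_smult phases_cnj_mult[OF e(1)] one_smult .
    hence "lxor v w = zlab 2" using conj_scalar_pauli_op[OF U] len by simp
    thus False using lxor_cancel[of v w] len nz(3) by auto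
  qed
  moreover have "comm_sign v' w' = 1"
    using comm_sign_conj[OF U len c(2) d(2) c(1) d(1) c(3) d(3) comm] .
  ultimately show ?thesis
    using semi_clifford_lagrangian[OF U lagrangian_2[OF len nz comm] lagrangian_2 c(1,3) d(1,3)] c(2) d(2) by blast
qed

section \<open>Gates mapping Pauli operators to Pauli operators, seen in dimension six\<close>

lemma conj_by_commute:
  assumes "unitary_gate n V" "A \<in> carrier_mat (2 ^ n) (2 ^ n)"
  shows "V * A = conj_by V A * V"
proof -
  note u = unitary_gateD[OF assms(1)]
  have "conj_by V A * V = V * A * (mat_adjoint V * V)"
    unfolding conj_by_def by (rule mat_assoc[of _ "2 ^ n"]) (use u assms in auto)
  thus ?thesis using u assms by simp
qed

lemma unitary_gate_2D:
  assumes "unitary_gate 2 U"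
  shows "U \<in> carrier_mat 4 4" "mat_adjoint U \<in> carrier_mat 4 4" "U * mat_adjoint U = 1\<^sub>m 4"
    "mat_adjoint U * U = 1\<^sub>m 4"
  using unitary_gateD[OF assms] by simp_all

lemma mult_index_sum:
  assumes "A \<in> carrier_mat m n" "B \<in> carrier_mat n p" "i < m" "j < p"
  shows "(A * B) $$ (i, j) = (\<Sum>k<n. A $$ (i, k) * B $$ (k, j))"
  using assms by (simp add: scalar_prod_def lessThan_atLeast0)

lemma mult_pauli_diag_index:
  assumes "R \<in> carrier_mat 6 6" "x < 6" "y < 6"
  shows "(R * pauli_diag v) $$ (x, y) = R $$ (x, y) * pauli_sign v y"
    "(pauli_diag v * R) $$ (x, y) = pauli_sign v x * R $$ (x, y)"
proof -
  have "(R * pauli_diag v) $$ (x, y) = (\<Sum>z<6. R $$ (x, z) * (if z = y then pauli_sign v z else 0))"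
    using assms by (simp add: pauli_diag_def scalar_prod_def lessThan_atLeast0)
  also have "\<dots> = (\<Sum>z<6. if z = y then R $$ (x, z) * pauli_sign v z else 0)"
    by (intro sum.cong) auto
  also have "\<dots> = R $$ (x, y) * pauli_sign v y" using assms by simp
  finally show "(R * pauli_diag v) $$ (x, y) = R $$ (x, y) * pauli_sign v y" .
  have "(pauli_diag v * R) $$ (x, y) = (\<Sum>z<6. (if x = z then pauli_sign v x else 0) * R $$ (z, y))"
    using assms by (simp add: pauli_diag_def scalar_prod_def lessThan_atLeast0)
  also have "\<dots> = (\<Sum>z<6. if x = z then pauli_sign v x * R $$ (z, y) else 0)"
    by (intro sum.cong) auto
  also have "\<dots> = pauli_sign v x * R $$ (x, y)" using assms by simp
  finally show "(pauli_diag v * R) $$ (x, y) = pauli_sign v x * R $$ (x, y)" .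
qed

text \<open>The relation \<open>V P = c P' V\<close> becomes \<open>R D = c^2 D' R\<close> with
  \<open>D\<close>, \<open>D'\<close> diagonal. So wherever row \<open>x\<close> of \<open>R\<close>
  is nonzero, the diagonal of \<open>D\<close> has the one value \<open>c^2\<close> times entry
  \<open>x\<close> of \<open>D'\<close>.\<close>

lemma asym_rep_maps_pauli:
  assumes V: "unitary_gate 2 V" and v: "length v = 2" and m: "maps_pauli 2 V v"
    and xyz: "x < 6" "y < 6" "z < 6" "asym_rep V $$ (x, y) \<noteq> 0" "asym_rep V $$ (x, z) \<noteq> 0"
  shows "pauli_sign v y = pauli_sign v z"
proof -
  note V4 = unitary_gate_2D[OF V]
  note R = asym_rep_carrier[OF V4(1)]
  obtain c v' where c: "c \<in> phases" "length v' = 2" "conj_by V (pauli_op v) = c \<cdot>\<^sub>m pauli_op v'"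
    using m by (auto simp: maps_pauli_def)
  have "V * pauli_op v = (c \<cdot>\<^sub>m pauli_op v') * V"
    using conj_by_commute[OF V, of "pauli_op v"] v c by simp
  hence "asym_rep V * pauli_diag v = ((c * c) \<cdot>\<^sub>m pauli_diag v') * asym_rep V"
    using asym_rep_mult[OF V4(1), of "pauli_op v"] asym_rep_mult[OF _ V4(1), of "c \<cdot>\<^sub>m pauli_op v'"]
      asym_rep_smult[of "pauli_op v'" c] v c(2) by (simp add: asym_rep_pauli_op)
  hence *: "asym_rep V * pauli_diag v = (c * c) \<cdot>\<^sub>m (pauli_diag v' * asym_rep V)"
    using smult_mult(1)[OF pauli_diag_carrier R] by simp
  hence eq: "asym_rep V $$ (x, t) * pauli_sign v t = c * c * (pauli_sign v' x * asym_rep V $$ (x, t))" if "t < 6" for t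
  proof -
    have "asym_rep V $$ (x, t) * pauli_sign v t = (asym_rep V * pauli_diag v) $$ (x, t)"
      by (rule mult_pauli_diag_index(1)[OF R xyz(1) that, symmetric])
    also have "\<dots> = ((c * c) \<cdot>\<^sub>m (pauli_diag v' * asym_rep V)) $$ (x, t)" using * by simp
    also have "\<dots> = c * c * (pauli_diag v' * asym_rep V) $$ (x, t)"
      using R xyz(1) that by (intro index_smult_mat(1)) (auto simp: pauli_diag_def)
    finally show ?thesis unfolding mult_pauli_diag_index(2)[OF R xyz(1) that] .
  qed
  have "pauli_sign v t = c * c * pauli_sign v' x" if "t < 6" "asym_rep V $$ (x, t) \<noteq> 0" for t
    using eq[OF that(1)] that(2) by simp
  thus ?thesis using xyz by metis
qed

text \<open>Columns are coloured by the signs of \<open>v\<close> and \<open>w\<close>. Their pairs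
  of points are disjoint, so the colours are these two pairs and the two remaining points. The minus
  sign matches the reflection \<open>1 - 2 P\<close>, as a Pauli operator acts with eigenvalue 1 of
  multiplicity two.\<close>

lemma class_supported_maps_pauli_pair:
  assumes "maps_pauli_pair V"
  shows "class_supported (\<lambda>x y. - asym_rep V $$ (x, y))"
proof -
  obtain v w where V: "unitary_gate 2 V" and vw: "commuting_pair v w" "maps_pauli 2 V v" "maps_pauli 2 V w"
    using assms by (auto simp: maps_pauli_pair_def)
  hence len: "length v = 2" "length w = 2" and nz: "v \<noteq> zlab 2" "w \<noteq> zlab 2" "v \<noteq> w"
    and comm: "comm_sign v w = 1" by (auto simp: commuting_pair_def)
  let ?S = "\<lambda>v. {x. x < 6 \<and> pauli_sign v x = 1}"
  define g where "g y = (pauli_sign v y = 1, pauli_sign w y = 1)" for y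
  have disj: "?S v \<inter> ?S w = {}" using pauli_sign_comm[OF len nz] comm by auto
  note S = card_pauli_sign[OF len(1) nz(1)] card_pauli_sign[OF len(2) nz(2)]
  have "card {y. y < 6 \<and> g y = l} \<le> 2" for l
  proof -
    have "card ({..<6} - (?S v \<union> ?S w)) = 2"
      using S card_Un_disjoint[OF _ _ disj] by (subst card_Diff_subset) auto
    hence "card T \<le> 2" if "T \<subseteq> ?S v \<or> T \<subseteq> ?S w \<or> T \<subseteq> {..<6} - (?S v \<union> ?S w)" for T
      using that S card_mono[of "?S v" T] card_mono[of "?S w" T] card_mono[of "{..<6} - (?S v \<union> ?S w)" T]
      by force
    moreover have "{y. y < 6 \<and> g y = l} \<subseteq> ?S v \<or> {y. y < 6 \<and> g y = l} \<subseteq> ?S w \<or>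
        {y. y < 6 \<and> g y = l} \<subseteq> {..<6} - (?S v \<union> ?S w)"
      by (cases l; cases "fst l"; cases "snd l") (auto simp: g_def)
    ultimately show ?thesis by blast
  qed
  moreover have "g y = g z"
    if "x < 6" "y < 6" "z < 6" "- asym_rep V $$ (x, y) \<noteq> 0" "- asym_rep V $$ (x, z) \<noteq> 0" for x y z
    using asym_rep_maps_pauli[OF V len(1) vw(2), of x y z] asym_rep_maps_pauli[OF V len(2) vw(3), of x y z] that
    by (simp add: g_def)
  ultimately show ?thesis unfolding class_supported_def by blast
qed

lemma class_supported_cong:
  assumes "class_supported M" "\<And>x y. x < 6 \<Longrightarrow> y < 6 \<Longrightarrow> M x y = N x y"
  shows "class_supported N"
  using assms unfolding class_supported_def by simp

lemma asym_rep_unitary: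
  assumes "unitary_gate 2 U"
  shows "asym_rep U * mat_adjoint (asym_rep U) = 1\<^sub>m 6" "mat_adjoint (asym_rep U) * asym_rep U = 1\<^sub>m 6"
proof -
  note u = unitary_gate_2D[OF assms]
  show "asym_rep U * mat_adjoint (asym_rep U) = 1\<^sub>m 6" "mat_adjoint (asym_rep U) * asym_rep U = 1\<^sub>m 6"
    using asym_rep_mult[OF u(1,2)] asym_rep_mult[OF u(2,1)] u(3,4) asym_rep_one
    by (simp_all add: asym_rep_adjoint[OF u(1)])
qed

lemma asym_rep_conj_pauli:
  assumes U: "unitary_gate 2 U" and v: "length v = 2"
  shows "asym_rep (conj_by U (pauli_op v)) = asym_rep U * pauli_diag v * mat_adjoint (asym_rep U)"
proof -
  note u = unitary_gate_2D[OF U]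
  have "U * pauli_op v \<in> carrier_mat 4 4" using u v by simp
  thus ?thesis unfolding conj_by_def using u v
    by (simp add: asym_rep_mult asym_rep_adjoint asym_rep_pauli_op)
qed

text \<open>Let \<open>v'\<close> be the label belonging to \<open>A'\<close>. The block structure
  gives \<open>R D = D' R\<close>, so the conjugated operator and \<open>pauli_op v'\<close> have
  the same image and differ by a scalar \<open>d\<close>; both square to the identity, hence
  \<open>d * d = 1\<close>.\<close>

lemma matched_maps_pauli:
  assumes U: "unitary_gate 2 U" and m: "matched (\<lambda>x y. asym_rep U $$ (x, y)) A A'"
    and v: "length v = 2" "\<And>x. x < 6 \<Longrightarrow> pauli_sign v x = (if x \<in> A then 1 else - 1)"
  shows "maps_pauli 2 U v"
proof -
  note u = unitary_gate_2D[OF U]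
  let ?R = "asym_rep U"
  note R = asym_rep_carrier[OF u(1)]
  have R': "mat_adjoint ?R \<in> carrier_mat 6 6" using R by simp
  obtain v' where v': "length v' = 2" "\<And>x. x < 6 \<Longrightarrow> pauli_sign v' x = (if x \<in> A' then 1 else - 1)"
    using m duad_exists[of A'] unfolding matched_def by metis
  have RD: "?R * pauli_diag v = pauli_diag v' * ?R"
  proof (rule eq_matI)
    fix x y assume "x < dim_row (pauli_diag v' * ?R)" "y < dim_col (pauli_diag v' * ?R)"
    hence xy: "x < 6" "y < 6" using R by (auto simp: pauli_diag_def)
    have "?R $$ (x, y) = 0 \<or> (x \<in> A' \<longleftrightarrow> y \<in> A)" using m xy by (auto simp: matched_def)
    thus "(?R * pauli_diag v) $$ (x, y) = (pauli_diag v' * ?R) $$ (x, y)"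
      unfolding mult_pauli_diag_index[OF R xy] v(2)[OF xy(2)] v'(2)[OF xy(1)] by auto
  qed (use R in \<open>auto simp: pauli_diag_def\<close>)
  define V where "V = conj_by U (pauli_op v)"
  have V: "V \<in> carrier_mat 4 4" using conj_by_carrier[OF U, of "pauli_op v"] v(1) by (simp add: V_def)
  have W: "pauli_op v' \<in> carrier_mat 4 4" and WW: "pauli_op v' * pauli_op v' = 1\<^sub>m 4"
    using v'(1) pauli_op_square[of v'] by simp_all
  have "asym_rep V = pauli_diag v' * (?R * mat_adjoint ?R)"
    unfolding V_def asym_rep_conj_pauli[OF U v(1)] RD by (rule mat_assoc[OF pauli_diag_carrier R R'])
  hence "asym_rep V = asym_rep (pauli_op v')"
    using asym_rep_unitary[OF U] asym_rep_pauli_op[OF v'(1)] pauli_diag_carrier[of v'] by simp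
  hence "asym_rep (pauli_op v' * V) = asym_rep (pauli_op v' * pauli_op v')"
    using asym_rep_mult[OF W V] asym_rep_mult[OF W W] by simp
  hence "asym_rep (pauli_op v' * V) = 1 \<cdot>\<^sub>m 1\<^sub>m 6" unfolding WW asym_rep_one one_smult .
  then obtain d where d: "pauli_op v' * V = d \<cdot>\<^sub>m 1\<^sub>m 4"
    using asym_rep_scalar[of "pauli_op v' * V" 1] W V by auto
  have "V = pauli_op v' * pauli_op v' * V" unfolding WW using V by simp
  also have "\<dots> = pauli_op v' * (d \<cdot>\<^sub>m 1\<^sub>m 4)" unfolding d[symmetric] by (rule mat_assoc[OF W W V])
  also have "\<dots> = d \<cdot>\<^sub>m pauli_op v'" using smult_mult(2)[OF W one_carrier_mat, of d] W by simp
  finally have Vd: "V = d \<cdot>\<^sub>m pauli_op v'" .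
  have "V * V = 1\<^sub>m 4"
    using conj_by_mult[OF U, of "pauli_op v" "pauli_op v"] v(1) pauli_op_square[of v] conj_by_one[OF U]
    by (simp add: V_def)
  hence "(d * d) \<cdot>\<^sub>m 1\<^sub>m 4 = 1\<^sub>m 4" unfolding Vd smult_mult(3)[OF W W] WW .
  hence "((d * d) \<cdot>\<^sub>m 1\<^sub>m 4) $$ (0, 0) = (1\<^sub>m 4 :: complex mat) $$ (0, 0)" by simp
  hence "d \<in> phases" by (intro phasesI_square) simp
  thus ?thesis using Vd v'(1) unfolding V_def maps_pauli_def by blast
qed

text \<open>The hypothesis, applied to the label of each pair of columns, puts the matrix of
  \<open>U\<close> into the locale. Two disjoint matched pairs then yield two commuting labels
  mapped to Pauli operators.\<close>

lemma maps_pauli_pair_step: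
  assumes U: "unitary_gate 2 U"
    and step: "\<And>v. length v = 2 \<Longrightarrow> maps_pauli_pair (conj_by U (pauli_op v))"
  shows "maps_pauli_pair U"
proof -
  note u = unitary_gate_2D[OF U]
  define Q where "Q x y = asym_rep U $$ (x, y)" for x y
  note R = asym_rep_carrier[OF u(1)] and unit = asym_rep_unitary[OF U]
  have Rd: "dim_row (asym_rep U) = 6" "dim_col (asym_rep U) = 6" using R by auto
  have rows: "(\<Sum>z<6. Q x z * cnj (Q y z)) = (if x = y then 1 else 0)" if "x < 6" "y < 6" for x y
    using arg_cong[OF unit(1), of "\<lambda>M. M $$ (x, y)"] that Rd
    by (simp add: Q_def scalar_prod_def lessThan_atLeast0)
  have cols: "(\<Sum>z<6. Q z x * cnj (Q z y)) = (if x = y then 1 else 0)" if "x < 6" "y < 6" for x y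
  proof -
    have "(\<Sum>z<6. cnj (Q z y) * Q z x) = (if y = x then 1 else 0)"
      using arg_cong[OF unit(2), of "\<lambda>M. M $$ (y, x)"] that Rd
      by (simp add: Q_def scalar_prod_def lessThan_atLeast0)
    thus ?thesis by (simp only: mult.commute eq_commute[of y])
  qed
  \<comment> \<open>The label of \<open>{i, j}\<close> acts as \<open>2 E - 1\<close> with
    \<open>E\<close> the coordinate projector. Conjugation by \<open>Q\<close> turns
    \<open>E\<close> into the projector onto columns \<open>i\<close> and \<open>j\<close>, and row
    orthonormality handles the identity.\<close>
  have refl: "class_supported (\<lambda>x y. (if x = y then 1 else 0) - 2 * (Q x i * cnj (Q y i) + Q x j * cnj (Q y j)))"
    if ij: "i < 6" "j < 6" "i \<noteq> j" for i j
  proof -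
    have "{i, j} \<subseteq> {..<6}" "card {i, j} = 2" using ij by auto
    then obtain v where v: "length v = 2" "\<And>x. x < 6 \<Longrightarrow> pauli_sign v x = (if x \<in> {i, j} then 1 else - 1)"
      using duad_exists by metis
    have "- asym_rep (conj_by U (pauli_op v)) $$ (x, y) =
        (if x = y then 1 else 0) - 2 * (Q x i * cnj (Q y i) + Q x j * cnj (Q y j))" if xy: "x < 6" "y < 6" for x y
    proof -
      have RD: "asym_rep U * pauli_diag v \<in> carrier_mat 6 6" using R by simp
      have "asym_rep (conj_by U (pauli_op v)) $$ (x, y) = (\<Sum>z<6. (asym_rep U * pauli_diag v) $$ (x, z) * cnj (Q y z))"
        unfolding asym_rep_conj_pauli[OF U v(1)] mult_index_sum[OF RD mat_adjoint_carrier[OF R] xy]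
        using Rd xy by (intro sum.cong) (simp_all add: Q_def)
      also have "\<dots> = (\<Sum>z<6. Q x z * pauli_sign v z * cnj (Q y z))"
        using mult_pauli_diag_index(1)[OF R xy(1)] by (intro sum.cong) (auto simp: Q_def)
      also have "\<dots> = (\<Sum>z<6. 2 * (if z = i then Q x z * cnj (Q y z) else 0) +
          2 * (if z = j then Q x z * cnj (Q y z) else 0) - Q x z * cnj (Q y z))"
        using v(2) ij by (intro sum.cong) auto
      also have "\<dots> = 2 * (Q x i * cnj (Q y i) + Q x j * cnj (Q y j)) - (if x = y then 1 else 0)"
        using ij rows[OF xy] by (simp add: sum.distrib sum_subtractf flip: sum_distrib_left)
      finally show ?thesis by simp
    qed
    thus ?thesis using class_supported_cong[OF class_supported_maps_pauli_pair[OF step[OF v(1)]]] by simp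
  qed
  interpret class_supported_unitary Q
    using rows cols refl by unfold_locales
  obtain A B A' B' where AB: "matched Q A A'" "matched Q B B'" "A \<inter> B = {}"
    using two_matched_pairs by blast
  obtain v where v: "length v = 2" "\<And>x. x < 6 \<Longrightarrow> pauli_sign v x = (if x \<in> A then 1 else - 1)"
    using AB(1) duad_exists[of A] unfolding matched_def by metis
  obtain w where w: "length w = 2" "\<And>x. x < 6 \<Longrightarrow> pauli_sign w x = (if x \<in> B then 1 else - 1)"
    using AB(2) duad_exists[of B] unfolding matched_def by metis
  have zero: "pauli_sign (zlab 2) x = 1" for x
    by (simp add: pauli_sign_def) (simp add: zlab_2)
  have sub: "A \<subseteq> {..<6}" "card A = 2" "B \<subseteq> {..<6}" "card B = 2" using AB by (auto simp: matched_def)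
  have ne: "A \<noteq> {}" "B \<noteq> {}" using sub by auto
  \<comment> \<open>A point of each pair tells \<open>v\<close>, \<open>w\<close> and the zero label
    apart, whose signs are all 1.\<close>
  obtain x y where xy: "x \<in> A" "x < 6" "y \<in> B" "y < 6" using ne sub by blast
  have notin: "x \<notin> B" "y \<notin> A" using xy AB(3) by auto
  have nz: "v \<noteq> zlab 2" "w \<noteq> zlab 2" "v \<noteq> w"
    using v(2)[OF xy(4)] w(2)[OF xy(2)] v(2)[OF xy(2)] zero[of x] zero[of y] xy notin by auto
  have "comm_sign v w = 1"
    unfolding pauli_sign_comm[OF v(1) w(1) nz] using v(2) w(2) AB(3) by auto
  hence "commuting_pair v w" using v(1) w(1) nz by (simp add: commuting_pair_def)
  moreover have "maps_pauli 2 U v" "maps_pauli 2 U w"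
    using matched_maps_pauli[OF U _ v(1)] matched_maps_pauli[OF U _ w(1)] AB(1,2) v(2) w(2)
    unfolding Q_def[abs_def] by blast+
  ultimately show ?thesis using U unfolding maps_pauli_pair_def by blast
qed

section \<open>Induction on the level for two qubits\<close>

lemma unitary_pauli_set: "A \<in> pauli_set n \<Longrightarrow> unitary_gate n A"
  by (elim pauli_setE) (simp add: unitary_gate_smult unitary_pauli_op phases_cnj_mult)

lemma conj_by_pauli_op:
  assumes "length u = n" "length v = n"
  shows "conj_by (pauli_op u) (pauli_op v) = comm_sign u v \<cdot>\<^sub>m pauli_op v"
proof -
  have c: "pauli_op u \<in> carrier_mat (2 ^ n) (2 ^ n)" "pauli_op v \<in> carrier_mat (2 ^ n) (2 ^ n)" using assms by auto
  have "conj_by (pauli_op u) (pauli_op v) = comm_sign u v \<cdot>\<^sub>m (pauli_op v * pauli_op u * pauli_op u)"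
    unfolding conj_by_def pauli_op_adjoint using pauli_op_comm[of u v] assms
      smult_mult(1)[OF mat_sq_mult[OF c(2,1)] c(1)] by simp
  also have "pauli_op v * pauli_op u * pauli_op u = pauli_op v"
    using mat_assoc[OF c(2) c(1) c(1)] pauli_op_square[of u] right_mult_one_mat[OF c(2)] assms by simp
  finally show ?thesis .
qed

lemma conj_by_scaled:
  assumes "a \<in> phases" "U \<in> carrier_mat N N" "A \<in> carrier_mat N N"
  shows "conj_by (a \<cdot>\<^sub>m U) A = conj_by U A"
proof -
  have "mat_adjoint U \<in> carrier_mat N N" using assms by simp
  thus ?thesis using assms unfolding conj_by_def mat_adjoint_smult
    by (simp add: smult_mult[of _ N] smult_smult phases_cnj_mult one_smult)
qed

lemma comm_sign_phase: "comm_sign u v \<in> phases"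
  using comm_sign_cases[of u v] by auto

text \<open>At level one, conjugation only changes signs of Pauli operators, so any commuting pair
  serves. Above it, the conjugated Pauli operators lie one level lower and the previous lemmas give
  the step.\<close>

lemma clifford_hierarchy_2:
  "U \<in> clifford_hierarchy 2 (Suc k) \<Longrightarrow> maps_pauli_pair U"
proof (induction k arbitrary: U)
  case 0
  then obtain a u where a: "a \<in> phases" "length u = 2" "U = a \<cdot>\<^sub>m pauli_op u" by (auto elim: pauli_setE)
  have "maps_pauli 2 U v" if "length v = 2" for v
    unfolding maps_pauli_def a(3)
    using conj_by_scaled[OF a(1), of "pauli_op u" 4 "pauli_op v"] conj_by_pauli_op[OF a(2) that] a(2) that comm_sign_phase
    by auto
  \<comment> \<open>The operators XI and IX.\<close>
  moreover have "commuting_pair [(True, False), (False, False)] [(False, False), (True, False)]"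
    by (simp add: commuting_pair_def zlab_2 sign1_def)
  ultimately show ?case
    using 0 unitary_pauli_set[of U 2] unfolding maps_pauli_pair_def
    by (metis clifford_hierarchy.simps(2) commuting_pair_def)
next
  case (Suc k)
  hence U: "unitary_gate 2 U" and *: "\<And>A. A \<in> pauli_set 2 \<Longrightarrow> conj_by U A \<in> clifford_hierarchy 2 (Suc k)"
    by auto
  show ?case
  proof (rule maps_pauli_pair_step[OF U])
    fix v :: "(bool \<times> bool) list" assume "length v = 2"
    hence "pauli_op v \<in> pauli_set 2" using pauli_setI[of 1 v 2] by (simp add: one_smult)
    thus "maps_pauli_pair (conj_by U (pauli_op v))" by (intro Suc.IH *)
  qed
qed

subsection \<open>One qubit\<close>

lemma unitary_kronecker:
  assumes "unitary_gate 1 U" "unitary_gate 1 V"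
  shows "unitary_gate 2 (kronecker U V)"
proof -
  note u = unitary_gateD[OF assms(1), simplified] and v = unitary_gateD[OF assms(2), simplified]
  show ?thesis
    using kronecker_mult[OF u(1,2) v(1,2)] kronecker_mult[OF u(2,1) v(2,1)] kronecker_carrier[OF u(1) v(1)]
      kronecker_one[of 2 2] u v
    by (simp add: unitary_gate_def kronecker_adjoint)
qed

lemma conj_by_kronecker:
  assumes "unitary_gate 1 U" "unitary_gate 1 V" "A \<in> carrier_mat 2 2" "B \<in> carrier_mat 2 2"
  shows "conj_by (kronecker U V) (kronecker A B) = kronecker (conj_by U A) (conj_by V B)"
proof -
  note u = unitary_gateD[OF assms(1), simplified] and v = unitary_gateD[OF assms(2), simplified]
  show ?thesis unfolding conj_by_def kronecker_adjoint
    using kronecker_mult[OF u(1) assms(3) v(1) assms(4)]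
      kronecker_mult[OF mat_sq_mult[OF u(1) assms(3)] u(2) mat_sq_mult[OF v(1) assms(4)] v(2)] by simp
qed

lemma pauli_op_1: "pauli_op [p] = pauli1 p"
  using kronecker_one_1 by simp

text \<open>Conjugating a product of Pauli matrices \<open>p\<close> and \<open>r\<close> replaces
  the second factor \<open>q\<close> by \<open>r\<close> up to sign, so the induction must run over
  all \<open>q\<close>. The sign is moved to the first factor, where the phase of a Pauli operator
  absorbs it.\<close>

lemma clifford_hierarchy_kronecker:
  "U \<in> clifford_hierarchy 1 (Suc k) \<Longrightarrow> kronecker U (pauli1 q) \<in> clifford_hierarchy 2 (Suc k)"
proof (induction k arbitrary: U q)
  case 0
  then obtain c v where c: "c \<in> phases" "length v = 1" "U = c \<cdot>\<^sub>m pauli_op v" by (auto elim: pauli_setE)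
  then obtain p where p: "v = [p]" by (auto simp: length_Suc_conv)
  have "kronecker U (pauli1 q) = kronecker (c \<cdot>\<^sub>m pauli1 p) (1 \<cdot>\<^sub>m pauli1 q)"
    unfolding c(3) p pauli_op_1 one_smult ..
  also have "\<dots> = c \<cdot>\<^sub>m pauli_op [p, q]"
    unfolding kronecker_smult using pauli_op_1[of q] by simp
  finally show ?case using pauli_setI[OF c(1), of "[p, q]" 2] by simp
next
  case (Suc k)
  hence U: "unitary_gate 1 U" and *: "\<And>A. A \<in> pauli_set 1 \<Longrightarrow> conj_by U A \<in> clifford_hierarchy 1 (Suc k)"
    by auto
  have q: "unitary_gate 1 (pauli1 q)" using unitary_pauli_op[of "[q]" 1] unfolding pauli_op_1 by simp
  have "conj_by (kronecker U (pauli1 q)) A \<in> clifford_hierarchy 2 (Suc k)" if "A \<in> pauli_set 2" for A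
  proof -
    obtain c v where c: "c \<in> phases" "length v = 2" "A = c \<cdot>\<^sub>m pauli_op v" using \<open>A \<in> pauli_set 2\<close> by (rule pauli_setE)
    then obtain p r where v: "v = [p, r]" by (auto simp: numeral_2_eq_2 length_Suc_conv)
    let ?s = "comm_sign [q] [r]"
    have A: "A = kronecker (c \<cdot>\<^sub>m pauli1 p) (pauli1 r)"
      using kronecker_smult[of c "pauli1 p" 1 "pauli1 r"] pauli_op_1[of r] by (simp add: c v one_smult)
    have "conj_by (kronecker U (pauli1 q)) A = kronecker (conj_by U (c \<cdot>\<^sub>m pauli1 p)) (?s \<cdot>\<^sub>m pauli1 r)"
      unfolding A using conj_by_kronecker[OF U q, of "c \<cdot>\<^sub>m pauli1 p" "pauli1 r"]
        conj_by_pauli_op[of "[q]" 1 "[r]"] unfolding pauli_op_1 by simp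
    also have "\<dots> = kronecker (?s \<cdot>\<^sub>m conj_by U (c \<cdot>\<^sub>m pauli1 p)) (pauli1 r)"
      using kronecker_smult[of 1 _ ?s "pauli1 r"] kronecker_smult[of ?s _ 1 "pauli1 r"] by (simp add: one_smult)
    also have "?s \<cdot>\<^sub>m conj_by U (c \<cdot>\<^sub>m pauli1 p) = conj_by U ((?s * c) \<cdot>\<^sub>m pauli_op [p])"
      unfolding pauli_op_1 using conj_by_smult[OF U, of "c \<cdot>\<^sub>m pauli1 p" ?s] by (simp add: smult_smult)
    finally have eq: "conj_by (kronecker U (pauli1 q)) A = kronecker (conj_by U ((?s * c) \<cdot>\<^sub>m pauli_op [p])) (pauli1 r)" .
    show ?thesis unfolding eq
      by (intro Suc.IH * pauli_setI phases_mult comm_sign_phase c(1)) simp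
  qed
  thus ?case using unitary_kronecker[OF U q] by auto
qed

text \<open>On one qubit only the identity and \<open>p\<close> itself commute with
  \<open>p\<close>, so one generator, taken twice, spans.\<close>

lemma lagrangian_1:
  assumes "p \<noteq> (False, False)"
  shows "lagrangian 1 [p] [p]"
proof -
  have *: "u = (False, False) \<or> u = p" if "sign1 u p = 1" for u
    using that assms by (cases u; cases p; cases "fst u"; cases "snd u"; cases "fst p"; cases "snd p") (auto simp: sign1_def)
  have "u \<in> {zlab 1, [p], [p], lxor [p] [p]}" if "length u = 1" "comm_sign u [p] = 1" for u
  proof -
    obtain t where "u = [t]" using \<open>length u = 1\<close> by (cases u) auto
    thus ?thesis using *[of t] that by auto
  qed
  thus ?thesis by (simp add: lagrangian_def)
qed

lemma pauli1_nonzero: "\<exists>r<2. \<exists>s<2. pauli1 q $$ (r, s) \<noteq> 0"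
proof (rule ccontr)
  assume "\<not> ?thesis"
  hence "(pauli1 q * pauli1 q) $$ (0, 0) = 0" by (auto simp: pauli1_mult_index simp del: index_mult_mat(1))
  thus False unfolding pauli1_square by simp
qed

text \<open>Entries are compared at a fixed position \<open>(r, s)\<close> of the second factor
  where \<open>pauli1 q\<close> is nonzero; the scalar is the resulting ratio.\<close>

lemma kronecker_cancel:
  assumes A: "A \<in> carrier_mat 2 2" and eq: "kronecker A (pauli1 q) = c \<cdot>\<^sub>m kronecker (pauli1 p') (pauli1 q')"
  shows "\<exists>e. A = e \<cdot>\<^sub>m pauli1 p'"
proof -
  obtain r s where rs: "r < 2" "s < 2" "pauli1 q $$ (r, s) \<noteq> 0" using pauli1_nonzero by blast
  have "A = (c * pauli1 q' $$ (r, s) / pauli1 q $$ (r, s)) \<cdot>\<^sub>m pauli1 p'"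
  proof (rule eq_matI)
    fix i j assume "i < dim_row ((c * pauli1 q' $$ (r, s) / pauli1 q $$ (r, s)) \<cdot>\<^sub>m pauli1 p')"
      "j < dim_col ((c * pauli1 q' $$ (r, s) / pauli1 q $$ (r, s)) \<cdot>\<^sub>m pauli1 p')"
    hence ij: "i < 2" "j < 2" by auto
    have b: "2 * i + r < 2 * 2" "(2 * i + r) div 2 = i" "(2 * i + r) mod 2 = r"
      "2 * j + s < 2 * 2" "(2 * j + s) div 2 = j" "(2 * j + s) mod 2 = s"
      using ij rs by auto
    have d: "dim_row A = 2" "dim_col A = 2" using A by auto
    have "kronecker A (pauli1 q) $$ (2 * i + r, 2 * j + s) = A $$ (i, j) * pauli1 q $$ (r, s)"
      using b d by simp
    moreover have "(c \<cdot>\<^sub>m kronecker (pauli1 p') (pauli1 q')) $$ (2 * i + r, 2 * j + s) =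
        c * (pauli1 p' $$ (i, j) * pauli1 q' $$ (r, s))"
      using b by simp
    ultimately have "A $$ (i, j) * pauli1 q $$ (r, s) = c * (pauli1 p' $$ (i, j) * pauli1 q' $$ (r, s))"
      using eq by simp
    thus "A $$ (i, j) = ((c * pauli1 q' $$ (r, s) / pauli1 q $$ (r, s)) \<cdot>\<^sub>m pauli1 p') $$ (i, j)"
      using rs(3) ij by (simp add: field_simps)
  qed (use A in auto)
  thus ?thesis by blast
qed

text \<open>Two distinct commuting nonidentity labels cannot both be trivial on the first qubit,
  since distinct nonidentity Pauli matrices on the second anticommute. The label that is nontrivial
  there gives a Pauli matrix \<open>p\<close> which \<open>U\<close> maps to a multiple of a Pauli
  matrix.\<close>

lemma semi_clifford_1:
  assumes U: "unitary_gate 1 U" and "maps_pauli_pair (kronecker U (pauli1 (False, False)))"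
  shows "semi_clifford 1 U"
proof -
  let ?I = "pauli1 (False, False)"
  have I: "unitary_gate 1 ?I" using unitary_pauli_op[of "[(False, False)]" 1] unfolding pauli_op_1 by simp
  obtain v w where vw: "commuting_pair v w" "maps_pauli 2 (kronecker U ?I) v" "maps_pauli 2 (kronecker U ?I) w"
    using assms(2) by (auto simp: maps_pauli_pair_def)
  have "\<exists>p q. p \<noteq> (False, False) \<and> maps_pauli 2 (kronecker U ?I) [p, q]"
  proof -
    obtain p q p' q' where l: "v = [p, q]" "w = [p', q']"
      using vw(1) unfolding commuting_pair_def by (metis length_2_label)
    have "p \<noteq> (False, False) \<or> p' \<noteq> (False, False)"
    proof (rule ccontr)
      assume "\<not> ?thesis"
      hence z: "p = (False, False)" "p' = (False, False)" by auto
      obtain a b a' b' where q: "q = (a, b)" "q' = (a', b')" by (metis surj_pair)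
      show False using vw(1) unfolding l commuting_pair_def z q zlab_2
        by (cases a; cases b; cases a'; cases b') (auto simp: sign1_def)
    qed
    thus ?thesis using vw l by blast
  qed
  then obtain p q c v' where p: "p \<noteq> (False, False)" and c: "c \<in> phases" "length v' = 2"
      "conj_by (kronecker U ?I) (pauli_op [p, q]) = c \<cdot>\<^sub>m pauli_op v'"
    unfolding maps_pauli_def by blast
  obtain p' q' where v': "v' = [p', q']" using c(2) by (auto simp: numeral_2_eq_2 length_Suc_conv)
  have two: "pauli_op [r, s] = kronecker (pauli1 r) (pauli1 s)" for r s
    using pauli_op_1[of s] by simp
  let ?A = "conj_by U (pauli1 p)"
  have A: "?A \<in> carrier_mat 2 2" using conj_by_carrier[OF U, of "pauli1 p"] by simp
  have "conj_by ?I (pauli1 q) = pauli1 q"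
    using conj_by_pauli_op[of "[(False, False)]" 1 "[q]"] unfolding pauli_op_1 by (simp add: sign1_def one_smult)
  hence "kronecker ?A (pauli1 q) = c \<cdot>\<^sub>m kronecker (pauli1 p') (pauli1 q')"
    using conj_by_kronecker[OF U I, of "pauli1 p" "pauli1 q"] c(3) unfolding v' two by simp
  then obtain e where e: "?A = e \<cdot>\<^sub>m pauli1 p'" using kronecker_cancel[OF A] by blast
  have "?A * ?A = 1\<^sub>m 2"
    using conj_by_mult[OF U, of "pauli1 p" "pauli1 p"] conj_by_one[OF U] by (simp add: pauli1_square)
  hence "(e * e) \<cdot>\<^sub>m 1\<^sub>m 2 = 1\<^sub>m 2"
    unfolding e smult_mult(3)[OF pauli1_carrier pauli1_carrier] pauli1_square .
  hence "((e * e) \<cdot>\<^sub>m 1\<^sub>m 2) $$ (0, 0) = (1\<^sub>m 2 :: complex mat) $$ (0, 0)" by simp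
  hence e1: "e \<in> phases" by (intro phasesI_square) simp
  have e2: "conj_by U (pauli_op [p]) = e \<cdot>\<^sub>m pauli_op [p']" unfolding pauli_op_1 by (rule e)
  have "p' \<noteq> (False, False)"
  proof
    assume "p' = (False, False)"
    hence "pauli_op [p'] = 1\<^sub>m (2 ^ 1)" using pauli_op_zero[of 1] by simp
    hence "[p] = zlab 1" using conj_scalar_pauli_op[OF U, of "[p]" e] e2 by simp
    thus False using p by simp
  qed
  thus ?thesis
    using semi_clifford_lagrangian[OF U lagrangian_1[OF p] lagrangian_1 e1 e2 e1 e2] by blast
qed

lemma clifford_hierarchy_unitary: "U \<in> clifford_hierarchy n k \<Longrightarrow> unitary_gate n U"
  by (cases "(n, k)" rule: clifford_hierarchy.cases) (auto intro: unitary_pauli_set)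

theorem theorem1:
  fixes n k :: nat and U :: "complex mat"
  assumes "n \<in> {1, 2}"
    and "k \<ge> 1"
    and "U \<in> clifford_hierarchy n k"
  shows "semi_clifford n U"
proof -
  obtain k' where k: "k = Suc k'" using assms(2) by (cases k) auto
  from assms(1) consider "n = 1" | "n = 2" by blast
  thus ?thesis
  proof cases
    case 1
    \<comment> \<open>One qubit is embedded into two by tensoring with the identity.\<close>
    have "maps_pauli_pair (kronecker U (pauli1 (False, False)))"
      using assms(3) unfolding 1 k by (intro clifford_hierarchy_2 clifford_hierarchy_kronecker)
    thus ?thesis using semi_clifford_1 clifford_hierarchy_unitary assms(3) unfolding 1 by blast
  next
    case 2
    thus ?thesis using assms(3) clifford_hierarchy_2 maps_pauli_pair_semi_clifford unfolding k by blast
  qed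
qed

end
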